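(* Let $q\ge 2$ be an integer and let $f$ be a formal Fourier series on $\mathbb{T}$. Then $\Gamma_q[f]$ is an isometry on $\ell^2(T_q)$ (i.e. the kernel $\Gamma_q[f]$ represents a bounded operator on $\ell^2(T_q)$ which is an isometry) if and only if $f$ is (the Fourier series of) an inner function.
   Context: $T_q$ denotes the (vertex set of the) infinite rooted $q$-homogeneous tree: there is a root $o$, and each vertex has exactly $q$ children. $d$ is the graph distance and $|\sigma| := d(o,\sigma)$. Write $\sigma_1\preccurlyeq\sigma_2$ if $\sigma_1,\sigma_2$ lie on a common geodesic ray starting at the root and $|\sigma_1|\le|\sigma_2|$. Let $\mathcal{C}\subset T_q\times T_q$ be the set of comparable pairs ($\sigma_1\preccurlyeq\sigma_2$ or $\sigma_2\preccurlyeq\sigma_1$), with indicator function $\mathbf{1}_{\mathcal{C}}$. $\mathbb{T}=\mathbb{R}/2\pi\mathbb{Z}$. A formal Fourier series $f\sim\sum_{n\in\mathbb{Z}}\widehat f(n)e^{in\theta}$ is an arbitrary sequence $(\widehat f(n))_{n\in\mathbb{Z}}$ of complex numbers; a function $f\in L^1(\mathbb{T})$ is identified with the series with coefficients $\widehat f(n)=\int_{\mathbb{T}} f(e^{i\theta})e^{-in\theta}\frac{d\theta}{2\pi}$. For a formal Fourier series $f$, $$\Gamma_q[f](\sigma_1,\sigma_2) := q^{-d(\sigma_1,\sigma_2)/2}\,\widehat f(|\sigma_1|-|\sigma_2|)\,\mathbf{1}_{\mathcal{C}}(\sigma_1,\sigma_2).$$ A bounded operator $A$ on $\ell^2(T_q)$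 is identified with its kernel $A(\sigma_1,\sigma_2)=\langle A\delta_{\sigma_2},\delta_{\sigma_1}\rangle$; a kernel represents a bounded operator if it is the kernel of some element of $B(\ell^2(T_q))$. An inner function is an $f\in L^\infty(\mathbb{T})$ with $\widehat f(n)=0$ for all $n<0$ and $|f|=1$ almost everywhere on $\mathbb{T}$. *)

theory Defs
  imports "HOL-Analysis.Analysis"
begin

section \<open>The rooted homogeneous tree\<close>

text \<open>The vertices are the finite words over \<open>{0, \<dots>, q - 1}\<close>: the root is the empty word, and the
  \<open>q\<close> children of \<open>x\<close> are the words \<open>x @ [i]\<close>.\<close>

definition tree :: "nat \<Rightarrow> nat list set" where
  "tree q = {x. set x \<subseteq> {..<q}}"

definition tree_edges :: "nat \<Rightarrow> (nat list \<times> nat list) set" where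
  "tree_edges q = {(x, y). x \<in> tree q \<and> y \<in> tree q \<and> (\<exists>i<q. y = x @ [i] \<or> x = y @ [i])}"

text \<open>A pair lies in the \<open>n\<close>-th relational power of the edge relation iff it is joined by a walk
  of length \<open>n\<close>.\<close>

definition tree_dist :: "nat \<Rightarrow> nat list \<Rightarrow> nat list \<Rightarrow> nat" where
  "tree_dist q x y = (LEAST n. (x, y) \<in> tree_edges q ^^ n)"

definition tree_level :: "nat \<Rightarrow> nat list \<Rightarrow> nat" where
  "tree_level q x = tree_dist q [] x"

definition geodesic_ray :: "nat \<Rightarrow> (nat \<Rightarrow> nat list) \<Rightarrow> bool" where
  "geodesic_ray q r \<longleftrightarrow> r 0 = [] \<and> (\<forall>n. r n \<in> tree q) \<and> (\<forall>m n. tree_dist q (r m) (r (m + n)) = n)"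

definition tree_le :: "nat \<Rightarrow> nat list \<Rightarrow> nat list \<Rightarrow> bool" where
  "tree_le q x y \<longleftrightarrow>
     (\<exists>r. geodesic_ray q r \<and> x \<in> range r \<and> y \<in> range r) \<and> tree_level q x \<le> tree_level q y"

definition comparable_pairs :: "nat \<Rightarrow> (nat list \<times> nat list) set" where
  "comparable_pairs q = {(x, y) \<in> tree q \<times> tree q. tree_le q x y \<or> tree_le q y x}"


section \<open>Bounded operators on \<open>\<ell>\<^sup>2(S)\<close>\<close>

text \<open>Elements of \<open>\<ell>\<^sup>2(S)\<close> are extended by 0 outside \<open>S\<close>, so that they are determined by their
  values on \<open>S\<close>. Operators are only meaningful on this carrier.\<close>

definition ell2 :: "'a set \<Rightarrow> ('a \<Rightarrow> complex) set" where
  "ell2 S = {u. (\<forall>x. x \<notin> S \<longrightarrow> u x = 0) \<and> (\<lambda>x. (cmod (u x))\<^sup>2) summable_on S}"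

definition ell2_inner :: "'a set \<Rightarrow> ('a \<Rightarrow> complex) \<Rightarrow> ('a \<Rightarrow> complex) \<Rightarrow> complex" where
  "ell2_inner S u v = (\<Sum>\<^sub>\<infinity>x\<in>S. u x * cnj (v x))"

definition ell2_norm :: "'a set \<Rightarrow> ('a \<Rightarrow> complex) \<Rightarrow> real" where
  "ell2_norm S u = sqrt (\<Sum>\<^sub>\<infinity>x\<in>S. (cmod (u x))\<^sup>2)"

definition delta :: "'a \<Rightarrow> 'a \<Rightarrow> complex" where
  "delta x = (\<lambda>y. if y = x then 1 else 0)"

definition bounded_op :: "'a set \<Rightarrow> (('a \<Rightarrow> complex) \<Rightarrow> ('a \<Rightarrow> complex)) \<Rightarrow> bool" where
  "bounded_op S A \<longleftrightarrow>
     (\<forall>u\<in>ell2 S. A u \<in> ell2 S) \<and>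
     (\<forall>u\<in>ell2 S. \<forall>v\<in>ell2 S. A (\<lambda>x. u x + v x) = (\<lambda>x. A u x + A v x)) \<and>
     (\<forall>u\<in>ell2 S. \<forall>c. A (\<lambda>x. c * u x) = (\<lambda>x. c * A u x)) \<and>
     (\<exists>C. \<forall>u\<in>ell2 S. ell2_norm S (A u) \<le> C * ell2_norm S u)"

definition op_kernel ::
    "'a set \<Rightarrow> (('a \<Rightarrow> complex) \<Rightarrow> ('a \<Rightarrow> complex)) \<Rightarrow> 'a \<Rightarrow> 'a \<Rightarrow> complex" where
  "op_kernel S A x y = ell2_inner S (A (delta y)) (delta x)"

definition represents ::
    "'a set \<Rightarrow> ('a \<Rightarrow> 'a \<Rightarrow> complex) \<Rightarrow> (('a \<Rightarrow> complex) \<Rightarrow> ('a \<Rightarrow> complex)) \<Rightarrow> bool" where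
  "represents S K A \<longleftrightarrow> bounded_op S A \<and> (\<forall>x\<in>S. \<forall>y\<in>S. op_kernel S A x y = K x y)"

definition isometry_on_ell2 :: "'a set \<Rightarrow> (('a \<Rightarrow> complex) \<Rightarrow> ('a \<Rightarrow> complex)) \<Rightarrow> bool" where
  "isometry_on_ell2 S A \<longleftrightarrow> (\<forall>u\<in>ell2 S. ell2_norm S (A u) = ell2_norm S u)"


section \<open>Fourier series on the circle\<close>

text \<open>A formal Fourier series is its coefficient sequence of type \<open>int \<Rightarrow> complex\<close>. A function on the
  circle is a function \<open>F\<close> on the complex plane of which only the values at the points \<open>cis \<theta>\<close> are
  used. Since \<open>\<theta> \<mapsto> F (cis \<theta>)\<close> is periodic, ``almost everywhere on the circle'' amounts to
  ``for almost every real \<open>\<theta>\<close>''. Elements of \<open>L\<^sup>\<infinity>\<close> are represented by Borel functions.\<close>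

definition fourier_coeff :: "(complex \<Rightarrow> complex) \<Rightarrow> int \<Rightarrow> complex" where
  "fourier_coeff F n =
     (LBINT \<theta>:{0..2*pi}. F (cis \<theta>) * cis (- (of_int n * \<theta>))) / complex_of_real (2 * pi)"

definition Linfty_circle :: "(complex \<Rightarrow> complex) set" where
  "Linfty_circle = {F. (\<lambda>\<theta>::real. F (cis \<theta>)) \<in> borel_measurable borel \<and>
     (\<exists>C::real. AE \<theta> in lborel. cmod (F (cis \<theta>)) \<le> C)}"

definition inner_function :: "(complex \<Rightarrow> complex) \<Rightarrow> bool" where
  "inner_function F \<longleftrightarrow> F \<in> Linfty_circle \<and> (\<forall>n<0. fourier_coeff F n = 0) \<and>
     (AE \<theta> in lborel. cmod (F (cis \<theta>)) = 1)"

definition Gamma_kernel :: "nat \<Rightarrow> (int \<Rightarrow> complex) \<Rightarrow> nat list \<Rightarrow> nat list \<Rightarrow> complex" where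
  "Gamma_kernel q f x y =
     complex_of_real (real q powr (- (real (tree_dist q x y) / 2))) *
     f (int (tree_level q x) - int (tree_level q y)) * indicator (comparable_pairs q) (x, y)"

end

theory Submission
  imports Defs
begin

text \<open>Both sides are equivalent to one condition on the coefficient sequence: \<open>f n = 0\<close> for \<open>n < 0\<close>, and
  the autocorrelations \<open>\<Sum>\<^sub>k f (k + j) \<cdot> cnj (f k)\<close> over \<open>k \<ge> 0\<close> are \<open>1\<close> for \<open>j = 0\<close> and \<open>0\<close> for
  \<open>j \<ge> 1\<close>.

  On the tree side (\<open>Gamma_isometry_iff\<close>), an operator is an isometry iff the columns of its kernel are
  orthonormal. A vertex has \<open>q ^ k\<close> descendants at distance \<open>k\<close>, and the squared weight there is
  \<open>q\<close> to the power \<open>-k\<close>; the two cancel, so that summing over the descendants of a vertex turns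
  into summing over \<open>k\<close> with weight one (\<open>has_sum_by_level\<close>). The column of the root has squared norm
  \<open>\<Sum>\<^sub>k \<bar>f k\<bar>\<^sup>2\<close>. The column of a vertex at level \<open>m\<close> has in addition entries at the ancestors, which
  carry \<open>f (-1), \<dots>, f (-m)\<close>; since this column has norm one as well, these coefficients vanish. Once
  they do, the columns of two vertices at distance \<open>j\<close>, one below the other, have the \<open>j\<close>-th
  autocorrelation as inner product up to a nonzero factor, and columns of incomparable vertices have
  disjoint supports.

  On the circle side (\<open>inner_function_iff_autocorrelation\<close>), the autocorrelations are the Fourier
  coefficients of \<open>\<bar>H\<bar>\<^sup>2\<close>, where \<open>H\<close> is the square integrable function with coefficients \<open>f\<close>
  (\<open>L2_function_of_coefficients\<close>, a form of the Riesz--Fischer theorem). The condition says that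
  \<open>\<bar>H\<bar>\<^sup>2\<close> has the coefficients of the constant one, hence equals it almost everywhere, because an
  integrable function on the circle is determined by its coefficients
  (\<open>AE_zero_of_fourier_coefficients\<close>). The same uniqueness, together with Bessel's inequality,
  identifies a given inner function with the \<open>H\<close> built from its coefficients.\<close>

section \<open>Distance and order on the tree\<close>

lemma Nil_in_tree [simp]: "[] \<in> tree q"
  by (simp add: tree_def)

lemma append_in_tree [simp]: "x @ y \<in> tree q \<longleftrightarrow> x \<in> tree q \<and> y \<in> tree q"
  by (auto simp: tree_def)

lemma walk_length_bound:
  "(x, y) \<in> tree_edges q ^^ n \<Longrightarrow> length y \<le> length x + n \<and> length x \<le> length y + n"
proof (induction n arbitrary: y)
  case (Suc n)
  then obtain z where "(x, z) \<in> tree_edges q ^^ n" "(z, y) \<in> tree_edges q"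
    by auto
  with Suc.IH[of z] show ?case
    by (auto simp: tree_edges_def)
qed simp

lemma walk_downwards: "x @ w \<in> tree q \<Longrightarrow> (x, x @ w) \<in> tree_edges q ^^ length w"
proof (induction w rule: rev_induct)
  case (snoc i w)
  then have "(x @ w, x @ w @ [i]) \<in> tree_edges q"
    by (auto simp: tree_edges_def tree_def)
  with snoc show ?case
    by (auto intro!: relcompI)
qed simp

lemma sym_tree_edges: "sym (tree_edges q)"
  by (auto simp: sym_def tree_edges_def)

lemma walk_reverse: "(x, y) \<in> tree_edges q ^^ n \<Longrightarrow> (y, x) \<in> tree_edges q ^^ n"
proof (induction n arbitrary: y)
  case (Suc n)
  then obtain z where "(x, z) \<in> tree_edges q ^^ n" "(z, y) \<in> tree_edges q"
    by auto
  with Suc.IH[of z] sym_tree_edges[of q] show ?case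
    by (metis relpow_Suc_I2 symD)
qed simp

lemma tree_dist_append:
  assumes "x @ w \<in> tree q"
  shows "tree_dist q x (x @ w) = length w" "tree_dist q (x @ w) x = length w"
proof -
  show "tree_dist q x (x @ w) = length w"
    unfolding tree_dist_def
    by (rule Least_equality) (use walk_downwards[OF assms] walk_length_bound in force)+
  show "tree_dist q (x @ w) x = length w"
    unfolding tree_dist_def
    by (rule Least_equality)
      (use walk_reverse[OF walk_downwards[OF assms]] walk_length_bound in force)+
qed

lemma tree_level_eq_length: "x \<in> tree q \<Longrightarrow> tree_level q x = length x"
  using tree_dist_append(1)[of "[]" x q] by (simp add: tree_level_def)

text \<open>Going through the root joins any two vertices, so the least element in the definition of
  the distance is attained.\<close>

lemma walk_of_length_tree_dist:
  assumes "x \<in> tree q" "y \<in> tree q"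
  shows "(x, y) \<in> tree_edges q ^^ tree_dist q x y"
proof -
  have "(x, y) \<in> tree_edges q ^^ (length x + length y)"
    using walk_reverse[OF walk_downwards[of "[]" x q]] walk_downwards[of "[]" y q] assms
    by (auto simp: relpow_add)
  then show ?thesis
    unfolding tree_dist_def by (rule LeastI)
qed

text \<open>Consecutive vertices of a ray are adjacent and the levels increase by one, so each vertex is the
  parent of the next. This makes a geodesic ray the sequence of prefixes of an infinite word.\<close>

lemma geodesic_ray_take:
  assumes "geodesic_ray q r"
  shows "r m = take m (r (m + n))"
proof -
  have r: "r 0 = []" "\<And>n. r n \<in> tree q" "\<And>m n. tree_dist q (r m) (r (m + n)) = n"
    using assms by (auto simp: geodesic_ray_def)
  have len: "length (r n) = n" for n
    using r(3)[of 0 n] tree_level_eq_length[OF r(2)[of n]] by (simp add: r(1) tree_level_def)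
  have step: "r n = take n (r (Suc n))" for n
  proof -
    have "(r n, r (Suc n)) \<in> tree_edges q"
      using walk_of_length_tree_dist[OF r(2)[of n] r(2)[of "Suc n"]] r(3)[of n 1] by simp
    then obtain i where "r (Suc n) = r n @ [i] \<or> r n = r (Suc n) @ [i]"
      by (auto simp: tree_edges_def)
    then show ?thesis
      using len[of n] len[of "Suc n"] by auto
  qed
  show ?thesis
  proof (induction n)
    case (Suc n)
    then show ?case
      using step[of "m + n"] by (metis add_Suc_right le_add1 min.absorb1 take_take)
  qed (simp add: len)
qed

lemma tree_le_iff_prefix:
  assumes "q \<ge> 1"
  shows "tree_le q x y \<longleftrightarrow> y \<in> tree q \<and> (\<exists>w. y = x @ w)"
proof
  assume "tree_le q x y"
  then obtain r m n where r: "geodesic_ray q r" "x = r m" "y = r n"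
    and lev: "tree_level q x \<le> tree_level q y"
    by (auto simp: tree_le_def)
  have tree: "x \<in> tree q" "y \<in> tree q"
    using r by (auto simp: geodesic_ray_def)
  have "x = take (length x) y"
  proof (cases "m \<le> n")
    case True
    then have "x = take m y"
      using geodesic_ray_take[OF r(1), of m "n - m"] r by simp
    then show ?thesis
      by (metis append_eq_conv_conj append_take_drop_id)
  next
    case False
    then have "y = take n x"
      using geodesic_ray_take[OF r(1), of n "m - n"] r by simp
    moreover have "length x \<le> length y"
      using lev tree by (simp add: tree_level_eq_length)
    ultimately show ?thesis
      by (metis length_take min.bounded_iff order_refl take_all)
  qed
  then show "y \<in> tree q \<and> (\<exists>w. y = x @ w)"
    using tree by (metis append_take_drop_id)
next
  assume "y \<in> tree q \<and> (\<exists>w. y = x @ w)"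
  then obtain w where y: "y \<in> tree q" "y = x @ w"
    by blast
  \<comment> \<open>the ray through \<open>y\<close> that continues below \<open>y\<close> with zeros\<close>
  define r where "r n = take n y @ replicate (n - length y) 0" for n
  have r_tree: "r n \<in> tree q" for n
    using y(1) assms set_take_subset[of n y] by (auto simp: r_def tree_def)
  have r_length: "length (r n) = n" for n
    by (simp add: r_def)
  have "\<exists>w. r (m + n) = r m @ w \<and> length w = n" for m n
  proof -
    have "take m (r (m + n)) = r m"
      by (auto simp: r_def min_def)
    then show ?thesis
      by (intro exI[of _ "drop m (r (m + n))"]) (metis append_take_drop_id add_diff_cancel_left'
          length_drop r_length)
  qed
  then have "tree_dist q (r m) (r (m + n)) = n" for m n
    using tree_dist_append(1) r_tree by metis
  then have "geodesic_ray q r"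
    using r_tree by (auto simp: geodesic_ray_def r_def)
  moreover have "r (length x) = x" "r (length y) = y"
    using y(2) by (auto simp: r_def)
  ultimately show "tree_le q x y"
    using y rangeI[of r "length x"] rangeI[of r "length y"]
    by (auto simp: tree_le_def tree_level_eq_length intro!: exI[of _ r])
qed

lemma comparable_pairs_iff:
  assumes "q \<ge> 1"
  shows "(x, y) \<in> comparable_pairs q \<longleftrightarrow>
    x \<in> tree q \<and> y \<in> tree q \<and> ((\<exists>w. y = x @ w) \<or> (\<exists>w. x = y @ w))"
  using assms by (auto simp: comparable_pairs_def tree_le_iff_prefix)

section \<open>Entries of the kernel and sums over levels\<close>

lemma Gamma_kernel_descendant:
  assumes "q \<ge> 1" "y @ w \<in> tree q"
  shows "Gamma_kernel q f (y @ w) y = of_real (real q powr (- (real (length w) / 2))) * f (int (length w))"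
  using assms tree_dist_append(2)[OF assms(2)]
  by (simp add: Gamma_kernel_def tree_level_eq_length comparable_pairs_iff)

lemma Gamma_kernel_ancestor:
  assumes "q \<ge> 1" "x @ w \<in> tree q"
  shows "Gamma_kernel q f x (x @ w) = of_real (real q powr (- (real (length w) / 2))) * f (- int (length w))"
  using assms tree_dist_append(1)[OF assms(2)]
  by (simp add: Gamma_kernel_def tree_level_eq_length comparable_pairs_iff)

lemma Gamma_kernel_incomparable:
  assumes "q \<ge> 1" "\<nexists>w. y = x @ w" "\<nexists>w. x = y @ w"
  shows "Gamma_kernel q f x y = 0"
  using assms by (simp add: Gamma_kernel_def comparable_pairs_iff)

text \<open>Entries at proper ancestors carry a coefficient of negative index.\<close>

lemma Gamma_kernel_zero_off_descendants:
  assumes "q \<ge> 1" "\<And>n. n < 0 \<Longrightarrow> f n = 0" "x \<in> tree q" "y \<in> tree q" "\<nexists>w. x = y @ w"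
  shows "Gamma_kernel q f x y = 0"
proof (cases "\<exists>w. y = x @ w")
  case True
  then obtain w where w: "y = x @ w" "w \<noteq> []"
    using assms(5) by force
  then show ?thesis
    using assms Gamma_kernel_ancestor[of q x w f] by simp
qed (use assms Gamma_kernel_incomparable in blast)

lemma powr_neg_half_square:
  assumes "q \<ge> 1"
  shows "(real q powr (- (real n / 2)))\<^sup>2 = 1 / real q ^ n"
  using assms by (simp add: power2_eq_square flip: powr_add) (simp add: powr_minus powr_realpow divide_simps)

text \<open>There are \<open>q ^ k\<close> words of length \<open>k\<close>, so each level contributes exactly \<open>h k\<close>. The equivalence
  is needed in both directions: to read off sums of coefficients from sums over the tree, and to
  establish sums over the tree.\<close>

lemma has_sum_by_level:
  fixes h :: "nat \<Rightarrow> complex"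
  assumes "q \<ge> 1"
  shows "((\<lambda>w. h (length w) / of_nat q ^ length w) has_sum s) (tree q) \<longleftrightarrow> (h has_sum s) UNIV"
proof -
  define L where "L k = {w \<in> tree q. length w = k}" for k
  define g where "g = (\<lambda>(k, w::nat list). h k / of_nat q ^ k)"
  have L_eq: "L k = {w. set w \<subseteq> {..<q} \<and> length w = k}" for k
    by (auto simp: L_def tree_def)
  have fin: "finite (L k)" and card: "card (L k) = q ^ k" for k
    using finite_lists_length_eq[of "{..<q}" k] card_lists_length_eq[of "{..<q}" k]
    by (simp_all add: L_eq)
  have bij: "bij_betw (\<lambda>w. (length w, w)) (tree q) (Sigma UNIV L)"
    by (rule bij_betwI[where g = snd]) (auto simp: L_def)
  have level: "((\<lambda>w. g (k, w)) has_sum h k) (L k)" for k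
    using assms by (intro has_sum_finiteI fin) (simp add: g_def card)
  have level_norm: "((\<lambda>w. norm (g (k, w))) has_sum norm (h k)) (L k)" for k
    using assms by (intro has_sum_finiteI fin) (simp add: g_def card norm_divide norm_power)
  have "((\<lambda>w. h (length w) / of_nat q ^ length w) has_sum s) (tree q) \<longleftrightarrow> (g has_sum s) (Sigma UNIV L)"
    using has_sum_reindex_bij_betw[OF bij, of g s] by (simp add: g_def)
  also have "\<dots> \<longleftrightarrow> (h has_sum s) UNIV"
  proof
    assume "(g has_sum s) (Sigma UNIV L)"
    then show "(h has_sum s) UNIV"
      by (rule has_sum_SigmaD) (rule level)
  next
    assume h: "(h has_sum s) UNIV"
    then have "(\<lambda>k. norm (h k)) summable_on UNIV"
      using has_sum_imp_summable summable_on_iff_abs_summable_on_complex by blast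
    then have "(\<lambda>x. norm (g x)) summable_on Sigma UNIV L"
      by (intro summable_on_SigmaI[OF level_norm]) auto
    then have "g summable_on Sigma UNIV L"
      by (rule abs_summable_summable)
    then show "(g has_sum s) (Sigma UNIV L)"
      by (intro has_sum_SigmaI[OF level h])
  qed
  finally show ?thesis .
qed

section \<open>Isometries and orthonormal columns\<close>

lemma delta_in_ell2: "y \<in> S \<Longrightarrow> delta y \<in> ell2 S"
proof -
  assume "y \<in> S"
  moreover have "(\<lambda>x. (cmod (delta y x))\<^sup>2) summable_on S"
    by (rule finite_nonzero_values_imp_summable_on)
      (rule finite_subset[of _ "{y}"], auto simp: delta_def split: if_splits)
  ultimately show ?thesis
    by (auto simp: ell2_def delta_def)
qed

lemma ell2_inner_delta: "x \<in> S \<Longrightarrow> ell2_inner S u (delta x) = u x"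
  unfolding ell2_inner_def
  by (subst infsum_cong_neutral[where T = "{x}" and g = u]) (auto simp: delta_def)

lemma square_le_two_squares: "(a + b)\<^sup>2 \<le> 2 * a\<^sup>2 + 2 * (b::real)\<^sup>2"
  using sum_squares_bound[of a b] by (simp add: power2_sum)

lemma ell2_add:
  assumes "u \<in> ell2 S" "v \<in> ell2 S"
  shows "(\<lambda>x. u x + v x) \<in> ell2 S"
proof -
  have "(\<lambda>x. 2 * (cmod (u x))\<^sup>2 + 2 * (cmod (v x))\<^sup>2) summable_on S"
    using assms by (intro summable_on_add summable_on_cmult_right) (auto simp: ell2_def)
  then have "(\<lambda>x. (cmod (u x + v x))\<^sup>2) summable_on S"
    by (rule summable_on_comparison_test)
      (auto intro: order_trans[OF power_mono[OF norm_triangle_ineq] square_le_two_squares])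
  then show ?thesis
    using assms by (auto simp: ell2_def)
qed

lemma ell2_scale: "u \<in> ell2 S \<Longrightarrow> (\<lambda>x. c * u x) \<in> ell2 S"
  by (auto simp: ell2_def norm_mult power_mult_distrib intro: summable_on_cmult_right)

lemma product_summable_on:
  fixes a b :: "'a \<Rightarrow> complex"
  assumes "(\<lambda>x. (cmod (a x))\<^sup>2) summable_on S" "(\<lambda>x. (cmod (b x))\<^sup>2) summable_on S"
  shows "(\<lambda>x. a x * cnj (b x)) summable_on S"
proof -
  have "(\<lambda>x. (cmod (a x))\<^sup>2 + (cmod (b x))\<^sup>2) summable_on S"
    using assms by (rule summable_on_add)
  moreover have "cmod (a x * cnj (b x)) \<le> (cmod (a x))\<^sup>2 + (cmod (b x))\<^sup>2" for x
    using sum_squares_bound[of "cmod (a x)" "cmod (b x)"]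
      mult_nonneg_nonneg[OF norm_ge_zero[of "a x"] norm_ge_zero[of "b x"]]
    unfolding norm_mult complex_mod_cnj by linarith
  ultimately have "(\<lambda>x. cmod (a x * cnj (b x))) summable_on S"
    by (rule summable_on_comparison_test) auto
  then show ?thesis
    by (rule abs_summable_summable)
qed

text \<open>With \<open>c = 1\<close> and \<open>c = \<i>\<close> this recovers an inner product from squared norms.\<close>

lemma cmod_add_square:
  "(cmod (a + c * b))\<^sup>2 = (cmod a)\<^sup>2 + (cmod c)\<^sup>2 * (cmod b)\<^sup>2 + 2 * Re (cnj c * (a * cnj b))"
  unfolding cmod_power2 by (simp add: algebra_simps power2_eq_square)

lemma represents_imp_column:
  assumes "represents S K A" "x \<in> S" "y \<in> S"
  shows "A (delta y) x = K x y"
  using assms by (auto simp: represents_def op_kernel_def ell2_inner_delta)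

text \<open>The images of \<open>delta y\<close> are the columns, which therefore have norm one. For \<open>y \<noteq> y'\<close> and \<open>\<bar>c\<bar> = 1\<close> the
  image of \<open>delta y + c \<cdot> delta y'\<close> has squared norm two, which leaves no room for the cross term.\<close>

lemma isometry_imp_columns_orthonormal:
  assumes rep: "represents S K A" and iso: "isometry_on_ell2 S A" and "y \<in> S" "y' \<in> S"
  shows "((\<lambda>x. K x y * cnj (K x y')) has_sum (if y = y' then 1 else 0)) S"
proof -
  have lin: "A (\<lambda>x. u x + v x) = (\<lambda>x. A u x + A v x)" "A (\<lambda>x. c * u x) = (\<lambda>x. c * A u x)"
    "A u \<in> ell2 S"
    if "u \<in> ell2 S" "v \<in> ell2 S" for u v c
    using rep that by (auto simp: represents_def bounded_op_def)
  have norm: "((\<lambda>x. (cmod (A u x))\<^sup>2) has_sum (\<Sum>\<^sub>\<infinity>x\<in>S. (cmod (u x))\<^sup>2)) S" if "u \<in> ell2 S" for u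
  proof -
    have "sqrt (\<Sum>\<^sub>\<infinity>x\<in>S. (cmod (A u x))\<^sup>2) = sqrt (\<Sum>\<^sub>\<infinity>x\<in>S. (cmod (u x))\<^sup>2)"
      using iso that by (simp add: isometry_on_ell2_def ell2_norm_def)
    then show ?thesis
      using lin(3)[OF that that] has_sum_infsum[of "\<lambda>x. (cmod (A u x))\<^sup>2" S]
      by (simp add: ell2_def)
  qed
  have unit: "((\<lambda>x. (cmod (K x z))\<^sup>2) has_sum 1) S" if "z \<in> S" for z
  proof -
    have "(\<Sum>\<^sub>\<infinity>x\<in>S. (cmod (delta z x))\<^sup>2) = 1"
      using that by (subst infsum_cong_neutral[where T = "{z}" and g = "\<lambda>_. 1"]) (auto simp: delta_def)
    then have "((\<lambda>x. (cmod (A (delta z) x))\<^sup>2) has_sum 1) S"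
      using norm[OF delta_in_ell2[OF that]] by simp
    then show ?thesis
      by (rule has_sum_cong[THEN iffD1, rotated]) (simp add: represents_imp_column[OF rep _ that])
  qed
  show ?thesis
  proof (cases "y = y'")
    case True
    have "((\<lambda>x. complex_of_real ((cmod (K x y))\<^sup>2)) has_sum of_real 1) S"
      using unit[OF \<open>y \<in> S\<close>] by (rule has_sum_of_real)
    then show ?thesis
      using True by (simp only: complex_norm_square of_real_1 simp_thms if_True)
  next
    case False
    define I where "I = (\<Sum>\<^sub>\<infinity>x\<in>S. K x y * cnj (K x y'))"
    have I: "((\<lambda>x. K x y * cnj (K x y')) has_sum I) S"
      unfolding I_def
      by (intro has_sum_infsum product_summable_on has_sum_imp_summable[OF unit] assms)
    have "Re (cnj c * I) = 0" if "cmod c = 1" for c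
    proof -
      let ?u = "\<lambda>x. delta y x + c * delta y' x"
      have "((\<lambda>x. (cmod (K x y))\<^sup>2 + (cmod c)\<^sup>2 * (cmod (K x y'))\<^sup>2
          + 2 * Re (cnj c * (K x y * cnj (K x y')))) has_sum (1 + (cmod c)\<^sup>2 * 1 + 2 * Re (cnj c * I))) S"
        by (intro has_sum_add has_sum_cmult_right unit assms has_sum_Re I)
      then have *: "((\<lambda>x. (cmod (K x y + c * K x y'))\<^sup>2) has_sum (2 + 2 * Re (cnj c * I))) S"
        by (simp add: cmod_add_square that)
      have "A ?u x = K x y + c * K x y'" if "x \<in> S" for x
        using lin(1)[OF delta_in_ell2 ell2_scale[OF delta_in_ell2], of y y' c]
          lin(2)[OF delta_in_ell2 delta_in_ell2, of y' y' c] assms that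
        by (simp add: represents_imp_column[OF rep])
      then have "((\<lambda>x. (cmod (A ?u x))\<^sup>2) has_sum (2 + 2 * Re (cnj c * I))) S"
        using * by (simp cong: has_sum_cong)
      moreover have "((\<lambda>x. (cmod (A ?u x))\<^sup>2) has_sum 2) S"
      proof -
        have "(\<Sum>\<^sub>\<infinity>x\<in>S. (cmod (?u x))\<^sup>2) = (\<Sum>\<^sub>\<infinity>x\<in>{y, y'}. 1)"
          using assms False that by (intro infsum_cong_neutral) (auto simp: delta_def)
        also have "\<dots> = 2"
          using False by simp
        finally show ?thesis
          using norm[OF ell2_add[OF delta_in_ell2 ell2_scale[OF delta_in_ell2]], of y y' c] assms
          by simp
      qed
      ultimately show ?thesis
        using has_sum_unique by fastforce
    qed
    from this[of 1] this[of \<i>] have "I = 0"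
      by (auto simp: complex_eq_iff)
    then show ?thesis
      using I False by simp
  qed
qed

lemma has_sum_sum:
  fixes f :: "'i \<Rightarrow> 'a \<Rightarrow> 'b::{comm_monoid_add, topological_comm_monoid_add}"
  assumes "finite I" "\<And>i. i \<in> I \<Longrightarrow> (f i has_sum s i) S"
  shows "((\<lambda>x. \<Sum>i\<in>I. f i x) has_sum (\<Sum>i\<in>I. s i)) S"
  using assms by (induction I) (auto intro: has_sum_add)

text \<open>Since every row is finite, the value of the operator at a point involves only finitely many values
  of the argument. Finite combinations of columns satisfy Pythagoras' theorem, which bounds every
  finite piece of \<open>A u\<close> and makes \<open>A\<close> a contraction. That \<open>A\<close> does not shrink \<open>u\<close> follows from the
  parallelogram law: for finite \<open>F\<close> let \<open>v\<close> agree with \<open>u\<close> on \<open>F\<close> and with \<open>-u\<close> elsewhere. Then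
  \<open>A u + A v\<close> is twice the combination of the columns in \<open>F\<close>, whose norm is known, while \<open>A v\<close> is at
  most as long as \<open>v\<close>, hence as \<open>u\<close>.\<close>

lemma isometry_if_columns_orthonormal:
  assumes rows: "\<And>x. x \<in> S \<Longrightarrow> finite {y \<in> S. K x y \<noteq> 0}"
    and ortho: "\<And>y y'. y \<in> S \<Longrightarrow> y' \<in> S \<Longrightarrow>
      ((\<lambda>x. K x y * cnj (K x y')) has_sum (if y = y' then 1 else 0)) S"
  shows "\<exists>A. represents S K A \<and> isometry_on_ell2 S A"
proof -
  define A where "A u x = (if x \<in> S then \<Sum>y\<in>{y \<in> S. K x y \<noteq> 0}. K x y * u y else 0)"
    for u :: "'a \<Rightarrow> complex" and x
  define N where "N u = (\<Sum>\<^sub>\<infinity>x\<in>S. (cmod (u x))\<^sup>2)" for u :: "'a \<Rightarrow> complex"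
  have A_eq: "A u x = (\<Sum>y\<in>F. K x y * u y)"
    if "x \<in> S" "finite F" "F \<subseteq> S" "{y \<in> S. K x y \<noteq> 0} \<subseteq> F" for F u x
    using that by (auto simp: A_def intro!: sum.mono_neutral_left)
  have fin_isometry: "((\<lambda>x. (cmod (\<Sum>y\<in>F. K x y * u y))\<^sup>2) has_sum (\<Sum>y\<in>F. (cmod (u y))\<^sup>2)) S"
    if F: "finite F" "F \<subseteq> S" for F u
  proof -
    have "((\<lambda>x. \<Sum>y\<in>F. \<Sum>y'\<in>F. u y * cnj (u y') * (K x y * cnj (K x y'))) has_sum
        (\<Sum>y\<in>F. \<Sum>y'\<in>F. u y * cnj (u y') * (if y = y' then 1 else 0))) S"
      using F by (intro has_sum_sum has_sum_cmult_right ortho) auto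
    also have "(\<lambda>x. \<Sum>y\<in>F. \<Sum>y'\<in>F. u y * cnj (u y') * (K x y * cnj (K x y')))
        = (\<lambda>x. of_real ((cmod (\<Sum>y\<in>F. K x y * u y))\<^sup>2))"
      by (simp only: complex_norm_square cnj_sum complex_cnj_mult sum_product) (simp only: mult_ac)
    also have "(\<Sum>y\<in>F. \<Sum>y'\<in>F. u y * cnj (u y') * (if y = y' then 1 else 0))
        = of_real (\<Sum>y\<in>F. (cmod (u y))\<^sup>2)"
      using F by (simp add: complex_norm_square if_distrib of_real_sum del: of_real_power cong: if_cong)
    finally show ?thesis
      by (simp only: has_sum_of_real_iff)
  qed
  have contr: "A u \<in> ell2 S" "N (A u) \<le> N u" if u: "u \<in> ell2 S" for u
  proof -
    have bound: "(\<Sum>x\<in>X. (cmod (A u x))\<^sup>2) \<le> N u" if X: "finite X" "X \<subseteq> S" for X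
    proof -
      define F where "F = (\<Union>x\<in>X. {y \<in> S. K x y \<noteq> 0})"
      have F: "finite F" "F \<subseteq> S"
        using X rows by (auto simp: F_def)
      have "(\<Sum>x\<in>X. (cmod (A u x))\<^sup>2) = (\<Sum>x\<in>X. (cmod (\<Sum>y\<in>F. K x y * u y))\<^sup>2)"
        using X F by (intro sum.cong refl arg_cong[where f = "\<lambda>z. (cmod z)\<^sup>2"] A_eq) (auto simp: F_def)
      also have "\<dots> \<le> (\<Sum>y\<in>F. (cmod (u y))\<^sup>2)"
        using fin_isometry[OF F] X by (intro finite_sum_le_has_sum) auto
      also have "\<dots> \<le> N u"
        using u F unfolding N_def by (intro finite_sum_le_infsum) (auto simp: ell2_def)
      finally show ?thesis .
    qed
    have "(\<lambda>x. (cmod (A u x))\<^sup>2) summable_on S"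
      using bound by (intro nonneg_bdd_above_summable_on bdd_aboveI[of _ "N u"]) auto
    then show "A u \<in> ell2 S" "N (A u) \<le> N u"
      using bound by (auto simp: ell2_def N_def A_def intro!: infsum_le_finite_sums)
  qed
  have expand: "N u \<le> N (A u)" if u: "u \<in> ell2 S" for u
  proof -
    have "(\<Sum>y\<in>F. (cmod (u y))\<^sup>2) \<le> (N (A u) + N u) / 2" if F: "finite F" "F \<subseteq> S" for F
    proof -
      \<comment> \<open>the sum of \<open>u\<close> and its reflection \<open>v\<close> is twice the restriction of \<open>u\<close> to \<open>F\<close>\<close>
      define v where "v y = (if y \<in> F then u y else - u y)" for y
      have cmod_v: "cmod (v y) = cmod (u y)" for y
        by (simp add: v_def)
      have v: "v \<in> ell2 S"
        using u F unfolding ell2_def by (auto simp: cmod_v) (auto simp: v_def)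
      have "A u x + A v x = 2 * (\<Sum>y\<in>F. K x y * u y)" if x: "x \<in> S" for x
      proof -
        let ?R = "{y \<in> S. K x y \<noteq> 0} \<union> F"
        have "A u x + A v x = (\<Sum>y\<in>?R. K x y * u y + K x y * v y)"
          using x F rows by (simp add: A_eq[of x ?R] sum.distrib)
        also have "\<dots> = (\<Sum>y\<in>F. K x y * u y + K x y * v y)"
          using x F rows by (intro sum.mono_neutral_right) (auto simp: v_def)
        also have "\<dots> = (\<Sum>y\<in>F. 2 * (K x y * u y))"
          by (intro sum.cong) (auto simp: v_def)
        finally show ?thesis
          by (simp add: sum_distrib_left)
      qed
      moreover have "2 * (cmod c)\<^sup>2 \<le> (cmod a)\<^sup>2 + (cmod b)\<^sup>2" if "a + b = 2 * c" for a b c :: complex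
      proof -
        have "2 * cmod c \<le> cmod a + cmod b"
          using norm_triangle_ineq[of a b] that by (simp add: norm_mult)
        then have "(2 * cmod c)\<^sup>2 \<le> (cmod a + cmod b)\<^sup>2"
          by (intro power_mono) auto
        then show ?thesis
          using square_le_two_squares[of "cmod a" "cmod b"] by (simp add: power_mult_distrib)
      qed
      ultimately have *: "2 * (cmod (\<Sum>y\<in>F. K x y * u y))\<^sup>2 \<le> (cmod (A u x))\<^sup>2 + (cmod (A v x))\<^sup>2"
        if "x \<in> S" for x
        using that by blast
      have "2 * (\<Sum>y\<in>F. (cmod (u y))\<^sup>2) \<le> N (A u) + N (A v)"
      proof (rule has_sum_mono)
        show "((\<lambda>x. 2 * (cmod (\<Sum>y\<in>F. K x y * u y))\<^sup>2) has_sum (2 * (\<Sum>y\<in>F. (cmod (u y))\<^sup>2))) S"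
          using fin_isometry[OF F] by (rule has_sum_cmult_right)
        show "((\<lambda>x. (cmod (A u x))\<^sup>2 + (cmod (A v x))\<^sup>2) has_sum (N (A u) + N (A v))) S"
          using contr(1)[OF u] contr(1)[OF v] unfolding N_def
          by (intro has_sum_add has_sum_infsum) (auto simp: ell2_def)
      qed (use * in auto)
      also have "N (A v) \<le> N u"
        using contr(2)[OF v] by (simp add: N_def cmod_v)
      finally show ?thesis
        by simp
    qed
    then have "N u \<le> (N (A u) + N u) / 2"
      unfolding N_def[of u] using u by (intro infsum_le_finite_sums) (auto simp: ell2_def N_def)
    then show ?thesis
      by simp
  qed
  have iso: "ell2_norm S (A u) = ell2_norm S u" if "u \<in> ell2 S" for u
    using contr(2)[OF that] expand[OF that] by (simp add: ell2_norm_def N_def)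
  have "A (\<lambda>x. u x + v x) = (\<lambda>x. A u x + A v x)" "A (\<lambda>x. c * u x) = (\<lambda>x. c * A u x)" for u v c
    by (auto simp: A_def fun_eq_iff algebra_simps sum.distrib sum_distrib_left)
  then have "bounded_op S A"
    using contr(1) iso by (auto simp: bounded_op_def intro!: exI[of _ 1])
  moreover have "op_kernel S A x y = K x y" if "x \<in> S" "y \<in> S" for x y
    using that rows[of x]
    unfolding op_kernel_def ell2_inner_delta[OF that(1)]
    by (simp add: A_def delta_def if_distrib cong: if_cong)
  ultimately show ?thesis
    using iso by (auto simp: represents_def isometry_on_ell2_def)
qed

section \<open>The isometry condition on coefficients\<close>

text \<open>At the descendant \<open>y @ v @ w\<close> the two weights multiply to the constant \<open>q powr (- \<bar>v\<bar> / 2)\<close> times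
  \<open>1 / q ^ \<bar>w\<bar>\<close>, the reciprocal of the number of vertices on that level of the subtree.\<close>

lemma has_sum_columns_on_subtree:
  assumes q: "q \<ge> 1" and yv: "y @ v \<in> tree q"
  shows "((\<lambda>x. Gamma_kernel q f x y * cnj (Gamma_kernel q f x (y @ v))) has_sum
      of_real (real q powr (- (real (length v) / 2))) * s) ((@) (y @ v) ` tree q) \<longleftrightarrow>
    ((\<lambda>k. f (int (k + length v)) * cnj (f (int k))) has_sum s) UNIV"
    (is "(?g has_sum ?c * s) _ \<longleftrightarrow> (?h has_sum s) UNIV")
proof -
  have c: "?c \<noteq> 0"
    using q by simp
  have "?g ((y @ v) @ w) = ?c * (?h (length w) / of_nat q ^ length w)" if "w \<in> tree q" for w
  proof -
    let ?p = "\<lambda>n::nat. real q powr (- (real n / 2))"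
    have "?p (length (v @ w)) * ?p (length w) = ?p (length v) * (?p (length w))\<^sup>2"
      unfolding power2_eq_square powr_add[symmetric]
      by (rule arg_cong[where f = "(powr) (real q)"]) (simp add: field_simps)
    also have "\<dots> = ?p (length v) / real q ^ length w"
      using q by (simp add: powr_neg_half_square)
    finally have p: "complex_of_real (?p (length (v @ w))) * of_real (?p (length w)) = ?c / of_nat q ^ length w"
      unfolding of_real_mult[symmetric] by simp
    have "?g ((y @ v) @ w) = (of_real (?p (length (v @ w))) * of_real (?p (length w))) *
        (f (int (length (v @ w))) * cnj (f (int (length w))))"
      using Gamma_kernel_descendant[OF q, of y "v @ w" f] Gamma_kernel_descendant[OF q, of "y @ v" w f]
        yv that by (simp only: append_assoc append_in_tree simp_thms complex_cnj_mult
          complex_cnj_complex_of_real mult_ac)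
    then show ?thesis
      unfolding p by (simp add: add.commute)
  qed
  then have "(?g has_sum ?c * s) ((@) (y @ v) ` tree q) \<longleftrightarrow>
      ((\<lambda>w. ?c * (?h (length w) / of_nat q ^ length w)) has_sum ?c * s) (tree q)"
    by (subst has_sum_reindex) (auto simp: inj_on_def o_def intro!: has_sum_cong)
  also have "\<dots> \<longleftrightarrow> ((\<lambda>w. ?h (length w) / of_nat q ^ length w) has_sum s) (tree q)"
    using c by (subst has_sum_cmult_right_iff) auto
  finally show ?thesis
    using has_sum_by_level[OF q, of ?h s] by simp
qed

lemma has_sum_columns_on_tree:
  assumes q: "q \<ge> 1" and yv: "y @ v \<in> tree q" and f: "\<And>n. n < 0 \<Longrightarrow> f n = 0"
  shows "((\<lambda>x. Gamma_kernel q f x y * cnj (Gamma_kernel q f x (y @ v))) has_sum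
      of_real (real q powr (- (real (length v) / 2))) * s) (tree q) \<longleftrightarrow>
    ((\<lambda>k. f (int (k + length v)) * cnj (f (int k))) has_sum s) UNIV"
proof -
  have "Gamma_kernel q f x (y @ v) = 0" if "x \<in> tree q" "x \<notin> (@) (y @ v) ` tree q" for x
  proof (rule Gamma_kernel_zero_off_descendants[OF q f _ yv])
    show "\<nexists>w. x = (y @ v) @ w"
      using that by auto
  qed (use that in auto)
  then show ?thesis
    using yv unfolding has_sum_columns_on_subtree[OF q yv, symmetric]
    by (intro has_sum_cong_neutral) auto
qed

theorem Gamma_isometry_iff:
  assumes q: "q \<ge> 2"
  shows "(\<exists>A. represents (tree q) (Gamma_kernel q f) A \<and> isometry_on_ell2 (tree q) A) \<longleftrightarrow>
    (\<forall>n<0. f n = 0) \<and>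
    (\<forall>j::nat. ((\<lambda>k. f (int (k + j)) * cnj (f (int k))) has_sum (if j = 0 then 1 else 0)) UNIV)"
    (is "?isometry \<longleftrightarrow> ?analytic \<and> (\<forall>j. ?autocorrelation j)")
proof
  let ?K = "Gamma_kernel q f"
  have q1: "q \<ge> 1"
    using q by simp
  assume ?isometry
  then obtain A where A: "represents (tree q) ?K A" "isometry_on_ell2 (tree q) A"
    by blast
  note ortho = isometry_imp_columns_orthonormal[OF A]
  have norm: "?autocorrelation 0"
    using ortho[of "[]" "[]"] has_sum_columns_on_subtree[OF q1, of "[]" "[]" f 1] q1 by simp
  have analytic: "f (- int m) = 0" if m: "m > 0" for m
  proof -
    define y where "y = replicate m (0::nat)"
    have y: "y \<in> tree q" "length y = m" "y \<noteq> []"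
      using q m by (auto simp: y_def tree_def)
    let ?D = "(@) y ` tree q"
    have D: "?D \<subseteq> tree q" "[] \<notin> ?D"
      using y by auto
    have "((\<lambda>x. ?K x y * cnj (?K x y)) has_sum 1) (tree q)"
      using ortho[of y y] y by simp
    moreover have "((\<lambda>x. ?K x y * cnj (?K x y)) has_sum 1) ?D"
      using norm has_sum_columns_on_subtree[OF q1, of y "[]" f 1] y q1 by simp
    \<comment> \<open>the descendants of \<open>y\<close> exhaust the norm of the column, so the entry at the root vanishes\<close>
    ultimately have "((\<lambda>x. ?K x y * cnj (?K x y)) has_sum (1 - 1)) (tree q - ?D)"
      using D by (intro has_sum_Diff) auto
    then have "((\<lambda>x. complex_of_real ((cmod (?K x y))\<^sup>2)) has_sum of_real 0) (tree q - ?D)"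
      by (simp only: complex_norm_square diff_self of_real_0)
    then have "((\<lambda>x. (cmod (?K x y))\<^sup>2) has_sum 0) (tree q - ?D)"
      by (simp only: has_sum_of_real_iff)
    then have "(cmod (?K [] y))\<^sup>2 = 0"
      by (rule nonneg_has_sum_le_0D) (use D in auto)
    then show ?thesis
      using Gamma_kernel_ancestor[OF q1, of "[]" y f] y q1 by simp
  qed
  then have ?analytic
    by (metis int_cases3 neg_0_less_iff_less of_nat_less_0_iff add.inverse_inverse less_asym')
  moreover have "?autocorrelation j" for j
  proof (cases "j = 0")
    case False
    define v where "v = replicate j (0::nat)"
    have v: "v \<in> tree q" "length v = j" "v \<noteq> []"
      using q False by (auto simp: v_def tree_def)
    have "((\<lambda>x. ?K x [] * cnj (?K x v)) has_sum 0) (tree q)"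
      using ortho[of "[]" v] v by simp
    then show ?thesis
      using has_sum_columns_on_tree[OF q1, of "[]" v f 0] \<open>?analytic\<close> v False by simp
  qed (use norm in simp)
  ultimately show "?analytic \<and> (\<forall>j. ?autocorrelation j)"
    by blast
next
  let ?K = "Gamma_kernel q f"
  have q1: "q \<ge> 1"
    using q by simp
  assume *: "?analytic \<and> (\<forall>j. ?autocorrelation j)"
  then have f: "f n = 0" if "n < 0" for n
    using that by blast
  show ?isometry
  proof (rule isometry_if_columns_orthonormal)
    fix x assume x: "x \<in> tree q"
    have "{y \<in> tree q. ?K x y \<noteq> 0} \<subseteq> (\<lambda>n. take n x) ` {..length x}"
    proof
      fix y assume "y \<in> {y \<in> tree q. ?K x y \<noteq> 0}"
      then obtain w where "x = y @ w"
        using Gamma_kernel_zero_off_descendants[of q f x y] q1 f x by blast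
      then show "y \<in> (\<lambda>n. take n x) ` {..length x}"
        by (intro image_eqI[of _ _ "length y"]) auto
    qed
    then show "finite {y \<in> tree q. ?K x y \<noteq> 0}"
      by (rule finite_subset) simp
  next
    have ordered: "((\<lambda>x. ?K x y * cnj (?K x (y @ v))) has_sum (if v = [] then 1 else 0)) (tree q)"
      if "y @ v \<in> tree q" for y v
      using has_sum_columns_on_tree[of q y v f "if v = [] then 1 else 0", OF q1 that f] * q1
      by (auto dest: spec[of _ "length v"])
    fix y y' assume y: "y \<in> tree q" "y' \<in> tree q"
    show "((\<lambda>x. ?K x y * cnj (?K x y')) has_sum (if y = y' then 1 else 0)) (tree q)"
    proof (cases "(\<exists>v. y' = y @ v) \<or> (\<exists>v. y = y' @ v)")
      case True
      then show ?thesis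
      proof
        assume "\<exists>v. y' = y @ v"
        then obtain v where "y' = y @ v"
          by blast
        then show ?thesis
          using ordered[of y v] y by simp
      next
        assume "\<exists>v. y = y' @ v"
        then obtain v where v: "y = y' @ v"
          by blast
        then have "((\<lambda>x. cnj (?K x y' * cnj (?K x y))) has_sum cnj (if v = [] then 1 else 0)) (tree q)"
          using ordered[of y' v] y by (simp only: has_sum_cnj_iff)
        then show ?thesis
          using v by (simp add: mult.commute if_distrib cong: if_cong)
      qed
    next
      case False
      have "?K x y * cnj (?K x y') = 0" if x: "x \<in> tree q" for x
      proof (rule ccontr)
        assume "?K x y * cnj (?K x y') \<noteq> 0"
        then have "?K x y \<noteq> 0" "?K x y' \<noteq> 0"
          by auto
        then obtain w w' where "x = y @ w" "x = y' @ w'"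
          using Gamma_kernel_zero_off_descendants[of q f x y] Gamma_kernel_zero_off_descendants[of q f x y'] q1 f x y
          by blast
        then show False
          using False by (metis append_eq_append_conv2)
      qed
      then show ?thesis
        using False by (auto intro!: has_sum_0 simp del: mult_eq_0_iff)
    qed
  qed
qed

section \<open>Square integrable functions\<close>

definition L2 :: "'a measure \<Rightarrow> ('a \<Rightarrow> complex) set" where
  "L2 M = {g. g \<in> borel_measurable M \<and> integrable M (\<lambda>x. (cmod (g x))\<^sup>2)}"

lemma measurable_cnj [measurable (raw)]:
  "g \<in> borel_measurable M \<Longrightarrow> (\<lambda>x. cnj (g x)) \<in> borel_measurable M"
  by (rule borel_measurable_continuous_on) (intro continuous_intros)

lemma L2_measurable [measurable_dest]: "g \<in> L2 M \<Longrightarrow> g \<in> borel_measurable M"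
  by (simp add: L2_def)

lemma L2_integrable_square: "g \<in> L2 M \<Longrightarrow> integrable M (\<lambda>x. (cmod (g x))\<^sup>2)"
  by (simp add: L2_def)

lemma weighted_product_bound:
  fixes a b e :: real
  assumes "e > 0"
  shows "a * b \<le> (e * a\<^sup>2 + b\<^sup>2 / e) / 2"
proof -
  have "0 \<le> (e * a - b)\<^sup>2 / e"
    using assms by simp
  also have "\<dots> = e * a\<^sup>2 + b\<^sup>2 / e - 2 * (a * b)"
    using assms by (simp add: power2_eq_square field_simps)
  finally show ?thesis
    by simp
qed

lemma L2_integrable_product:
  assumes [measurable]: "g \<in> L2 M" "h \<in> L2 M"
  shows "integrable M (\<lambda>x. g x * cnj (h x))"
proof (rule Bochner_Integration.integrable_bound)
  show "integrable M (\<lambda>x. (cmod (g x))\<^sup>2 + (cmod (h x))\<^sup>2)"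
    using assms by (simp add: L2_integrable_square)
  have "cmod (g x * cnj (h x)) \<le> (cmod (g x))\<^sup>2 + (cmod (h x))\<^sup>2" for x
    using weighted_product_bound[of 1 "cmod (g x)" "cmod (h x)"]
    by (simp add: norm_mult) (smt (verit) zero_le_power2)
  then show "AE x in M. norm (g x * cnj (h x)) \<le> norm ((cmod (g x))\<^sup>2 + (cmod (h x))\<^sup>2)"
    by (auto intro: AE_I2 order_trans)
qed measurable

lemma L2_diff:
  assumes [measurable]: "g \<in> L2 M" "h \<in> L2 M"
  shows "(\<lambda>x. g x - h x) \<in> L2 M"
proof -
  have "integrable M (\<lambda>x. (cmod (g x - h x))\<^sup>2)"
  proof (rule Bochner_Integration.integrable_bound)
    show "integrable M (\<lambda>x. 2 * (cmod (g x))\<^sup>2 + 2 * (cmod (h x))\<^sup>2)"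
      using assms by (simp add: L2_integrable_square)
    have "(cmod (g x - h x))\<^sup>2 \<le> 2 * (cmod (g x))\<^sup>2 + 2 * (cmod (h x))\<^sup>2" for x
      by (rule order_trans[OF power_mono[OF norm_triangle_ineq4] square_le_two_squares]) simp
    then show "AE x in M. norm ((cmod (g x - h x))\<^sup>2) \<le> norm (2 * (cmod (g x))\<^sup>2 + 2 * (cmod (h x))\<^sup>2)"
      by (auto intro: AE_I2 order_trans)
  qed measurable
  then show ?thesis
    by (simp add: L2_def)
qed

lemma (in finite_measure) bounded_in_L2:
  assumes [measurable]: "g \<in> borel_measurable M" and "AE x in M. cmod (g x) \<le> C"
  shows "g \<in> L2 M"
proof -
  have "AE x in M. norm ((cmod (g x))\<^sup>2) \<le> C\<^sup>2"
    using assms(2) by eventually_elim (simp add: power_mono)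
  then have "integrable M (\<lambda>x. (cmod (g x))\<^sup>2)"
    by (rule integrable_const_bound) measurable
  then show ?thesis
    by (simp add: L2_def)
qed

lemma (in finite_measure) L2_integrable:
  assumes "g \<in> L2 M"
  shows "integrable M g"
proof -
  have "(\<lambda>_. 1) \<in> L2 M"
    by (rule bounded_in_L2[of _ 1]) auto
  from L2_integrable_product[OF assms this] show ?thesis
    by simp
qed

text \<open>Instead of the Cauchy--Schwarz inequality, \<open>2 a b \<le> e a\<^sup>2 + b\<^sup>2 / e\<close> is applied pointwise, with \<open>e\<close> small
  enough to make the contribution of the fixed function \<open>g\<close> negligible.\<close>

lemma L2_inner_tendsto:
  assumes g: "g \<in> L2 M" and H: "H \<in> L2 M" and S: "\<And>k::nat. S k \<in> L2 M"
    and lim: "(\<lambda>k. \<integral>x. (cmod (H x - S k x))\<^sup>2 \<partial>M) \<longlonglongrightarrow> 0"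
  shows "(\<lambda>k. \<integral>x. g x * cnj (S k x) \<partial>M) \<longlonglongrightarrow> (\<integral>x. g x * cnj (H x) \<partial>M)"
proof (rule LIMSEQ_I)
  fix r :: real assume r: "r > 0"
  define A where "A = (\<integral>x. (cmod (g x))\<^sup>2 \<partial>M)"
  have A: "A \<ge> 0"
    by (simp add: A_def)
  define e where "e = r / (A + 1)"
  have e: "e > 0" "e * A < r"
    using r A by (simp_all add: e_def field_simps)
  have "\<forall>\<^sub>F k in sequentially. (\<integral>x. (cmod (H x - S k x))\<^sup>2 \<partial>M) < r * e"
    using lim r e(1) by (intro order_tendstoD(2)) auto
  then obtain k0 where k0: "\<And>k. k \<ge> k0 \<Longrightarrow> (\<integral>x. (cmod (H x - S k x))\<^sup>2 \<partial>M) < r * e"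
    by (auto simp: eventually_sequentially)
  show "\<exists>k0. \<forall>k\<ge>k0. norm ((\<integral>x. g x * cnj (S k x) \<partial>M) - (\<integral>x. g x * cnj (H x) \<partial>M)) < r"
  proof (intro exI allI impI)
    fix k assume k: "k \<ge> k0"
    define B where "B = (\<integral>x. (cmod (H x - S k x))\<^sup>2 \<partial>M)"
    have D: "(\<lambda>x. H x - S k x) \<in> L2 M"
      using H S by (rule L2_diff)
    have "norm ((\<integral>x. g x * cnj (S k x) \<partial>M) - (\<integral>x. g x * cnj (H x) \<partial>M))
        = norm (\<integral>x. g x * cnj (H x - S k x) \<partial>M)"
      using L2_integrable_product[OF g H] L2_integrable_product[OF g S[of k]]
      by (simp add: right_diff_distrib norm_minus_commute)
    also have "\<dots> \<le> (\<integral>x. norm (g x * cnj (H x - S k x)) \<partial>M)"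
      by (rule integral_norm_bound)
    also have "\<dots> \<le> (\<integral>x. (e * (cmod (g x))\<^sup>2 + (cmod (H x - S k x))\<^sup>2 / e) / 2 \<partial>M)"
    proof (rule integral_mono)
      show "integrable M (\<lambda>x. norm (g x * cnj (H x - S k x)))"
        using g D by (intro integrable_norm L2_integrable_product)
      show "integrable M (\<lambda>x. (e * (cmod (g x))\<^sup>2 + (cmod (H x - S k x))\<^sup>2 / e) / 2)"
        using L2_integrable_square[OF g] L2_integrable_square[OF D] by simp
      show "norm (g x * cnj (H x - S k x)) \<le> (e * (cmod (g x))\<^sup>2 + (cmod (H x - S k x))\<^sup>2 / e) / 2"
        for x
        using weighted_product_bound[OF e(1), of "cmod (g x)" "cmod (H x - S k x)"]
        by (simp only: norm_mult complex_mod_cnj)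
    qed
    also have "\<dots> = (e * A + B / e) / 2"
      using L2_integrable_square[OF g] L2_integrable_square[OF D] by (simp add: A_def B_def)
    also have "\<dots> < r"
    proof -
      have "B / e < r"
        using e(1) k0[OF k] by (simp add: B_def divide_less_eq)
      then show ?thesis
        using e(2) by simp
    qed
    finally show "norm ((\<integral>x. g x * cnj (S k x) \<partial>M) - (\<integral>x. g x * cnj (H x) \<partial>M)) < r" .
  qed
qed

text \<open>The increments are bounded in \<open>L\<^sup>1\<close> by a geometric series, so their absolute values have an
  integrable and hence almost everywhere finite sum.\<close>

lemma (in finite_measure) fast_L2_Cauchy_AE_convergent:
  assumes S: "\<And>k. S k \<in> L2 M"
    and fast: "\<And>k. (\<integral>x. (cmod (S (Suc k) x - S k x))\<^sup>2 \<partial>M) \<le> (1/4) ^ k"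
  shows "AE x in M. convergent (\<lambda>k. S k x)"
proof -
  define D where "D k x = S (Suc k) x - S k x" for k x
  have D: "D k \<in> L2 M" for k
    unfolding D_def by (intro L2_diff S)
  have D_norm: "integrable M (\<lambda>x. cmod (D k x))" for k
    using L2_integrable[OF D] by (rule integrable_norm)
  have [measurable]: "D k \<in> borel_measurable M" for k
    by (rule L2_measurable[OF D])
  define C where "C = (measure M (space M) + 1) / 2"
  have "(\<integral>x. cmod (D k x) \<partial>M) \<le> C * (1/2) ^ k" for k
  proof -
    have "(\<integral>x. cmod (D k x) \<partial>M) \<le> (\<integral>x. ((1/2) ^ k + 2 ^ k * (cmod (D k x))\<^sup>2) / 2 \<partial>M)"
    proof (rule integral_mono)
      show "cmod (D k x) \<le> ((1/2) ^ k + 2 ^ k * (cmod (D k x))\<^sup>2) / 2" for x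
        \<comment> \<open>the weight balances an \<open>L\<^sup>2\<close> norm of order \<open>2\<close> to the power \<open>-k\<close>\<close>
        using weighted_product_bound[of "(1/2) ^ k" 1 "cmod (D k x)"] by (simp add: power_one_over mult.commute)
    qed (use D_norm L2_integrable_square[OF D] in auto)
    also have "\<dots> = ((1/2) ^ k * measure M (space M) + 2 ^ k * (\<integral>x. (cmod (D k x))\<^sup>2 \<partial>M)) / 2"
      using L2_integrable_square[OF D] by simp
    also have "\<dots> \<le> ((1/2) ^ k * measure M (space M) + 2 ^ k * (1/4) ^ k) / 2"
      using fast[of k] by (simp add: D_def)
    also have "(2::real) ^ k * (1/4) ^ k = (1/2) ^ k"
      by (simp flip: power_mult_distrib)
    finally show ?thesis
      by (simp add: C_def algebra_simps)
  qed
  then have summable: "summable (\<lambda>k. \<integral>x. cmod (D k x) \<partial>M)"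
    by (intro summable_comparison_test[OF _ summable_mult[OF summable_geometric, of "1/2" C]] exI[of _ 0])
      simp_all
  have "(\<integral>\<^sup>+x. (\<Sum>k. ennreal (cmod (D k x))) \<partial>M) = (\<Sum>k. \<integral>\<^sup>+x. ennreal (cmod (D k x)) \<partial>M)"
    by (rule nn_integral_suminf) measurable
  also have "\<dots> = (\<Sum>k. ennreal (\<integral>x. cmod (D k x) \<partial>M))"
    using D_norm by (simp add: nn_integral_eq_integral)
  finally have "(\<integral>\<^sup>+x. (\<Sum>k. ennreal (cmod (D k x))) \<partial>M) = (\<Sum>k. ennreal (\<integral>x. cmod (D k x) \<partial>M))" .
  moreover have "(\<Sum>k. ennreal (\<integral>x. cmod (D k x) \<partial>M)) \<noteq> top"
    by (rule ennreal_suminf_neq_top[OF summable]) simp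
  ultimately have "(\<integral>\<^sup>+x. (\<Sum>k. ennreal (cmod (D k x))) \<partial>M) \<noteq> \<infinity>"
    unfolding infinity_ennreal_def by metis
  then have "AE x in M. (\<Sum>k. ennreal (cmod (D k x))) \<noteq> \<infinity>"
    by (rule nn_integral_PInf_AE[rotated]) measurable
  then show ?thesis
  proof eventually_elim
    case (elim x)
    then have "summable (\<lambda>k. cmod (D k x))"
      by (intro summable_suminf_not_top) auto
    then have "summable (\<lambda>k. D k x)"
      by (rule summable_norm_cancel)
    then have "convergent (\<lambda>n. \<Sum>k<n. D k x)"
      by (simp add: summable_iff_convergent)
    moreover have "(\<Sum>k<n. D k x) = S n x - S 0 x" for n
      unfolding D_def by (rule sum_lessThan_telescope)
    ultimately have "convergent (\<lambda>n. S n x - S 0 x + S 0 x)"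
      by (intro convergent_add) (auto simp: convergent_const)
    then show ?case
      by simp
  qed
qed

text \<open>Almost everywhere convergence is upgraded to convergence in the mean by Fatou's lemma, applied to
  \<open>\<bar>S m - S k\<bar>\<^sup>2\<close> as \<open>m\<close> tends to infinity.\<close>

lemma (in finite_measure) fast_L2_Cauchy_limit:
  assumes S: "\<And>k. S k \<in> L2 M"
    and fast: "\<And>k m. k \<le> m \<Longrightarrow> (\<integral>x. (cmod (S m x - S k x))\<^sup>2 \<partial>M) \<le> (1/4) ^ k"
  shows "(\<lambda>x. lim (\<lambda>k. S k x)) \<in> L2 M"
    and "(\<lambda>k. \<integral>x. (cmod (lim (\<lambda>k. S k x) - S k x))\<^sup>2 \<partial>M) \<longlonglongrightarrow> 0"
proof -
  define H where "H x = lim (\<lambda>k. S k x)" for x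
  have [measurable]: "S k \<in> borel_measurable M" for k
    by (rule L2_measurable[OF S])
  have [measurable]: "H \<in> borel_measurable M"
    unfolding H_def by measurable
  have conv: "AE x in M. (\<lambda>k. S k x) \<longlonglongrightarrow> H x"
    using fast_L2_Cauchy_AE_convergent[of S] S fast[of _ "Suc _"]
    by (auto simp: H_def convergent_LIMSEQ_iff)
  have bound: "(\<integral>\<^sup>+x. ennreal ((cmod (H x - S k x))\<^sup>2) \<partial>M) \<le> ennreal ((1/4) ^ k)" for k
  proof -
    have "AE x in M. ennreal ((cmod (H x - S k x))\<^sup>2) = liminf (\<lambda>m. ennreal ((cmod (S m x - S k x))\<^sup>2))"
      using conv
    proof eventually_elim
      case (elim x)
      then have "(\<lambda>m. ennreal ((cmod (S m x - S k x))\<^sup>2)) \<longlonglongrightarrow> ennreal ((cmod (H x - S k x))\<^sup>2)"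
        by (intro tendsto_intros tendsto_ennrealI)
      then show ?case
        by (intro lim_imp_Liminf[symmetric]) auto
    qed
    then have "(\<integral>\<^sup>+x. ennreal ((cmod (H x - S k x))\<^sup>2) \<partial>M)
        = (\<integral>\<^sup>+x. liminf (\<lambda>m. ennreal ((cmod (S m x - S k x))\<^sup>2)) \<partial>M)"
      by (rule nn_integral_cong_AE)
    also have "\<dots> \<le> liminf (\<lambda>m. \<integral>\<^sup>+x. ennreal ((cmod (S m x - S k x))\<^sup>2) \<partial>M)"
      by (rule nn_integral_liminf) measurable
    also have "\<dots> \<le> limsup (\<lambda>m. \<integral>\<^sup>+x. ennreal ((cmod (S m x - S k x))\<^sup>2) \<partial>M)"
      by (rule Liminf_le_Limsup) simp
    also have "\<dots> \<le> ennreal ((1/4) ^ k)"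
    proof (rule Limsup_bounded)
      have "(\<integral>\<^sup>+x. ennreal ((cmod (S m x - S k x))\<^sup>2) \<partial>M) \<le> ennreal ((1/4) ^ k)" if "k \<le> m" for m
        using L2_integrable_square[OF L2_diff[OF S S]] fast[OF that]
        by (subst nn_integral_eq_integral) (auto intro: ennreal_leI)
      then show "\<forall>\<^sub>F m in sequentially.
          (\<integral>\<^sup>+x. ennreal ((cmod (S m x - S k x))\<^sup>2) \<partial>M) \<le> ennreal ((1/4) ^ k)"
        by (auto simp: eventually_sequentially)
    qed
    finally show ?thesis .
  qed
  have int: "integrable M (\<lambda>x. (cmod (H x - S k x))\<^sup>2)" for k
    using bound[of k] by (intro integrableI_bounded) (auto intro: le_less_trans ennreal_less_top)
  have "(\<lambda>x. H x - S 0 x) \<in> L2 M"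
    using int[of 0] by (simp add: L2_def)
  moreover have "(\<lambda>x. 0 - S 0 x) \<in> L2 M"
    by (rule L2_diff[OF _ S]) (simp add: L2_def)
  ultimately have "(\<lambda>x. (H x - S 0 x) - (0 - S 0 x)) \<in> L2 M"
    by (rule L2_diff)
  then show "(\<lambda>x. lim (\<lambda>k. S k x)) \<in> L2 M"
    by (simp add: H_def)
  have "(\<integral>x. (cmod (H x - S k x))\<^sup>2 \<partial>M) \<le> (1/4) ^ k" for k
    using bound[of k] int[of k] by (simp add: nn_integral_eq_integral)
  then show "(\<lambda>k. \<integral>x. (cmod (lim (\<lambda>k. S k x) - S k x))\<^sup>2 \<partial>M) \<longlonglongrightarrow> 0"
    unfolding H_def[symmetric]
    by (intro real_tendsto_sandwich[OF _ _ tendsto_const LIMSEQ_power_zero[of "1/4::real"]]) auto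
qed

text \<open>The positive and the negative part of \<open>g\<close> are densities of two finite measures that agree on
  half-lines, hence everywhere. As \<open>ennreal\<close> sends negative numbers to zero, these densities are
  \<open>ennreal (g x)\<close> and \<open>ennreal (- g x)\<close>.\<close>

lemma AE_zero_of_half_lines:
  fixes g :: "real \<Rightarrow> real"
  assumes sets_M [measurable_cong]: "sets M = sets borel" and g: "integrable M g"
    and zero: "\<And>a. (\<integral>x. g x * indicator {a<..} x \<partial>M) = 0"
  shows "AE x in M. g x = 0"
proof -
  have g_borel [measurable]: "g \<in> borel_measurable M"
    using g by (rule borel_measurable_integrable)
  have fin: "(\<integral>\<^sup>+x. ennreal (g x) \<partial>M) < \<infinity>" "(\<integral>\<^sup>+x. ennreal (- g x) \<partial>M) < \<infinity>"
    using g by (auto simp: real_integrable_def top.not_eq_extremum)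
  have half_line: "emeasure (density M (\<lambda>x. ennreal (h x))) {a<..} = (\<integral>\<^sup>+x. ennreal (h x * indicator {a<..} x) \<partial>M)"
    if [measurable]: "h \<in> borel_measurable M" for h :: "real \<Rightarrow> real" and a
    by (subst emeasure_density) (auto intro!: nn_integral_cong split: split_indicator)
  have le: "(\<integral>\<^sup>+x. ennreal (h x * indicator {a<..} x) \<partial>M) \<le> (\<integral>\<^sup>+x. ennreal (h x) \<partial>M)"
    for h :: "real \<Rightarrow> real" and a
    by (intro nn_integral_mono) (auto split: split_indicator)
  have "density M (\<lambda>x. ennreal (g x)) = density M (\<lambda>x. ennreal (- g x))"
  proof (rule measure_eqI_lessThan)
    fix a
    show "emeasure (density M (\<lambda>x. ennreal (g x))) {a<..} < \<infinity>"
      using le[of g a] fin(1) by (simp add: half_line)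
    have int: "integrable M (\<lambda>x. g x * indicator {a<..} x)"
      using integrable_mult_indicator[of "{a<..}" M g] g by (simp add: sets_M mult.commute)
    have fin': "(\<integral>\<^sup>+x. ennreal (g x * indicator {a<..} x) \<partial>M) < \<infinity>"
      "(\<integral>\<^sup>+x. ennreal (- g x * indicator {a<..} x) \<partial>M) < \<infinity>"
      using le[of g a] le[of "\<lambda>x. - g x" a] fin by (auto intro: le_less_trans)
    have "enn2real (\<integral>\<^sup>+x. ennreal (g x * indicator {a<..} x) \<partial>M)
        = enn2real (\<integral>\<^sup>+x. ennreal (- g x * indicator {a<..} x) \<partial>M)"
      using real_lebesgue_integral_def[OF int] zero[of a] by simp
    then show "emeasure (density M (\<lambda>x. ennreal (g x))) {a<..}
        = emeasure (density M (\<lambda>x. ennreal (- g x))) {a<..}"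
      using fin' by (simp add: half_line) (metis ennreal_enn2real)
  qed (simp_all add: sets_M)
  then have "AE x in M. ennreal (g x) = ennreal (- g x)"
    using fin(1) by (subst (asm) finite_density_unique) auto
  then show ?thesis
  proof eventually_elim
    case (elim x)
    show ?case
    proof (cases "g x \<ge> 0")
      case True
      then show ?thesis
        using elim by (simp add: ennreal_neg ennreal_eq_0_iff)
    next
      case False
      then show ?thesis
        using elim ennreal_eq_0_iff[of "- g x"] by (auto simp: ennreal_neg)
    qed
  qed
qed

section \<open>Normalised Lebesgue measure on the circle\<close>

definition circle_measure :: "real measure" where
  "circle_measure = density lborel (\<lambda>\<theta>. ennreal (indicator {0..2*pi} \<theta> / (2 * pi)))"

lemma sets_circle_measure [simp, measurable_cong]: "sets circle_measure = sets borel"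
  and space_circle_measure [simp]: "space circle_measure = UNIV"
  by (simp_all add: circle_measure_def)

lemma AE_circle_measure:
  "(AE \<theta> in circle_measure. P \<theta>) \<longleftrightarrow> (AE \<theta> in lborel. \<theta> \<in> {0..2*pi} \<longrightarrow> P \<theta>)"
  unfolding circle_measure_def by (subst AE_density) (auto simp: indicator_def)

lemma emeasure_circle_measure: "emeasure circle_measure UNIV = 1"
proof -
  have "emeasure circle_measure UNIV = (\<integral>\<^sup>+\<theta>. ennreal (1 / (2 * pi)) * indicator {0..2*pi} \<theta> \<partial>lborel)"
    unfolding circle_measure_def
    by (subst emeasure_density) (auto intro!: nn_integral_cong split: split_indicator)
  also have "\<dots> = ennreal (1 / (2 * pi)) * ennreal (2 * pi)"
    by (simp add: nn_integral_cmult_indicator)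
  also have "\<dots> = 1"
    by (simp flip: ennreal_mult)
  finally show ?thesis .
qed

interpretation circle: finite_measure circle_measure
  by (rule finite_measureI) (simp add: emeasure_circle_measure)

lemma measure_circle_measure [simp]: "measure circle_measure UNIV = 1"
  by (simp add: measure_def emeasure_circle_measure)

lemma integral_circle_measure:
  fixes g :: "real \<Rightarrow> complex"
  assumes "g \<in> borel_measurable borel"
  shows "(\<integral>\<theta>. g \<theta> \<partial>circle_measure) = (LBINT \<theta>:{0..2*pi}. g \<theta>) / complex_of_real (2 * pi)"
proof -
  have "(\<integral>\<theta>. g \<theta> \<partial>circle_measure) = (\<integral>\<theta>. (indicator {0..2*pi} \<theta> / (2 * pi)) *\<^sub>R g \<theta> \<partial>lborel)"
    unfolding circle_measure_def using assms by (intro integral_density) auto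
  also have "\<dots> = (\<integral>\<theta>. (1 / (2 * pi)) *\<^sub>R (indicator {0..2*pi} \<theta> *\<^sub>R g \<theta>) \<partial>lborel)"
    by simp
  also have "\<dots> = (1 / (2 * pi)) *\<^sub>R (LBINT \<theta>:{0..2*pi}. g \<theta>)"
    unfolding set_lebesgue_integral_def by (rule integral_scaleR_right)
  finally show ?thesis
    by (simp only: scaleR_conv_of_real of_real_divide of_real_1 times_divide_eq_left mult_1)
qed

lemma borel_measurable_cis [measurable]: "cis \<in> borel_measurable borel"
  by (intro borel_measurable_continuous_onI continuous_intros)

lemma fourier_coeff_eq:
  assumes [measurable]: "(\<lambda>\<theta>. F (cis \<theta>)) \<in> borel_measurable borel"
  shows "fourier_coeff F n = (\<integral>\<theta>. F (cis \<theta>) * cis (- (of_int n * \<theta>)) \<partial>circle_measure)"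
  unfolding fourier_coeff_def by (subst integral_circle_measure) auto

lemma integral_cis:
  "(\<integral>\<theta>. cis (of_int n * \<theta>) \<partial>circle_measure) = (if n = 0 then 1 else 0)"
proof (cases "n = 0")
  case False
  \<comment> \<open>an antiderivative, which is periodic\<close>
  define P where "P \<theta> = cis (of_int n * \<theta>) / (\<i> * of_int n)" for \<theta>
  have "(P has_vector_derivative cis (of_int n * \<theta>)) (at \<theta> within X)" for \<theta> X
    unfolding P_def has_vector_derivative_def using False
    by (auto intro!: derivative_eq_intros simp: fun_eq_iff scaleR_conv_of_real field_simps)
  then have "(\<integral>\<theta>. indicator {0..2*pi} \<theta> *\<^sub>R cis (of_int n * \<theta>) \<partial>lborel) = P (2 * pi) - P 0"
    by (intro integral_FTC_Icc continuous_intros) auto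
  also have "P (2 * pi) = P 0"
    using cis_multiple_2pi[of "of_int n"] by (simp add: P_def mult.commute)
  finally show ?thesis
    using False by (subst integral_circle_measure) (auto simp: set_lebesgue_integral_def)
qed simp

lemma cis_L2: "(\<lambda>\<theta>. cis (of_int n * \<theta>)) \<in> L2 circle_measure"
  by (rule circle.bounded_in_L2[of _ 1]) auto

lemma L2_mult_cis:
  assumes [measurable]: "g \<in> L2 circle_measure"
  shows "(\<lambda>\<theta>. g \<theta> * cis (c * \<theta>)) \<in> L2 circle_measure"
proof -
  have "(\<lambda>\<theta>. g \<theta> * cis (c * \<theta>)) \<in> borel_measurable circle_measure"
    by measurable
  then show ?thesis
    using assms by (simp add: L2_def norm_mult)
qed

definition analytic_polynomial :: "(nat \<Rightarrow> complex) \<Rightarrow> nat set \<Rightarrow> real \<Rightarrow> complex" where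
  "analytic_polynomial c A \<theta> = (\<Sum>n\<in>A. c n * cis (of_int (int n) * \<theta>))"

lemma analytic_polynomial_L2: "analytic_polynomial c A \<in> L2 circle_measure"
proof (rule circle.bounded_in_L2)
  show "analytic_polynomial c A \<in> borel_measurable circle_measure"
    unfolding analytic_polynomial_def by measurable
  have "cmod (analytic_polynomial c A \<theta>) \<le> (\<Sum>n\<in>A. cmod (c n))" for \<theta>
    unfolding analytic_polynomial_def by (rule order_trans[OF norm_sum]) (simp add: norm_mult)
  then show "AE \<theta> in circle_measure. cmod (analytic_polynomial c A \<theta>) \<le> (\<Sum>n\<in>A. cmod (c n))"
    by simp
qed

lemma inner_analytic_polynomial:
  assumes "g \<in> L2 circle_measure"
  shows "(\<integral>\<theta>. g \<theta> * cnj (analytic_polynomial c A \<theta>) \<partial>circle_measure) =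
    (\<Sum>n\<in>A. cnj (c n) * (\<integral>\<theta>. g \<theta> * cis (- (of_int (int n) * \<theta>)) \<partial>circle_measure))"
proof -
  have int: "integrable circle_measure (\<lambda>\<theta>. g \<theta> * cis (- (of_int (int n) * \<theta>)))" for n
    using circle.L2_integrable[OF L2_mult_cis[OF assms, of "- of_int (int n)"]] by simp
  have "(\<integral>\<theta>. g \<theta> * cnj (analytic_polynomial c A \<theta>) \<partial>circle_measure) =
      (\<integral>\<theta>. (\<Sum>n\<in>A. cnj (c n) * (g \<theta> * cis (- (of_int (int n) * \<theta>)))) \<partial>circle_measure)"
    unfolding analytic_polynomial_def
    by (intro Bochner_Integration.integral_cong refl)
      (simp add: sum_distrib_left cis_cnj mult_ac)
  also have "\<dots> = (\<Sum>n\<in>A. cnj (c n) * (\<integral>\<theta>. g \<theta> * cis (- (of_int (int n) * \<theta>)) \<partial>circle_measure))"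
    using int by (subst Bochner_Integration.integral_sum) auto
  finally show ?thesis .
qed

lemma inner_cis_analytic_polynomial:
  assumes "finite A"
  shows "(\<integral>\<theta>. cis (of_int m * \<theta>) * cnj (analytic_polynomial c A \<theta>) \<partial>circle_measure) =
    (if m \<ge> 0 \<and> nat m \<in> A then cnj (c (nat m)) else 0)"
proof -
  have "(\<integral>\<theta>. cis (of_int m * \<theta>) * cis (- (of_int (int n) * \<theta>)) \<partial>circle_measure) = (if m = int n then 1 else 0)" for n
    using integral_cis[of "m - int n"] by (simp add: cis_mult algebra_simps)
  then have "(\<integral>\<theta>. cis (of_int m * \<theta>) * cnj (analytic_polynomial c A \<theta>) \<partial>circle_measure) =
      (\<Sum>n\<in>A. if m = int n then cnj (c n) else 0)"
    by (subst inner_analytic_polynomial[OF cis_L2]) (auto intro!: sum.cong)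
  also have "\<dots> = (\<Sum>n\<in>A. if n = nat m then (if m \<ge> 0 then cnj (c n) else 0) else 0)"
    by (intro sum.cong) auto
  finally show ?thesis
    using assms by simp
qed

lemma norm_analytic_polynomial:
  assumes "finite A"
  shows "(\<integral>\<theta>. (cmod (analytic_polynomial c A \<theta>))\<^sup>2 \<partial>circle_measure) = (\<Sum>n\<in>A. (cmod (c n))\<^sup>2)"
proof -
  let ?p = "analytic_polynomial c A"
  have "(\<integral>\<theta>. ?p \<theta> * cis (- (of_int (int n) * \<theta>)) \<partial>circle_measure) = c n" if "n \<in> A" for n
  proof -
    have "(\<integral>\<theta>. ?p \<theta> * cis (- (of_int (int n) * \<theta>)) \<partial>circle_measure)
        = cnj (\<integral>\<theta>. cis (of_int (int n) * \<theta>) * cnj (?p \<theta>) \<partial>circle_measure)"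
      by (subst Bochner_Integration.integral_cnj[symmetric]) (simp add: cis_cnj mult.commute)
    then show ?thesis
      using that assms by (simp only: inner_cis_analytic_polynomial) simp
  qed
  then have "(\<integral>\<theta>. ?p \<theta> * cnj (?p \<theta>) \<partial>circle_measure) = (\<Sum>n\<in>A. cnj (c n) * c n)"
    by (subst inner_analytic_polynomial[OF analytic_polynomial_L2]) simp
  moreover have "(\<integral>\<theta>. ?p \<theta> * cnj (?p \<theta>) \<partial>circle_measure)
      = of_real (\<integral>\<theta>. (cmod (?p \<theta>))\<^sup>2 \<partial>circle_measure)"
    by (simp only: complex_norm_square[symmetric] integral_complex_of_real)
  moreover have "(\<Sum>n\<in>A. cnj (c n) * c n) = of_real (\<Sum>n\<in>A. (cmod (c n))\<^sup>2)"
    by (simp add: complex_norm_square mult.commute of_real_sum del: of_real_power)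
  ultimately show ?thesis
    by (metis of_real_eq_iff)
qed

section \<open>Functions with prescribed coefficients\<close>

text \<open>The partial sums are Cauchy in the mean; along a subsequence the distances become small enough for
  \<open>fast_L2_Cauchy_limit\<close>.\<close>

lemma Riesz_Fischer_analytic:
  assumes c: "summable (\<lambda>n. (cmod (c n))\<^sup>2)"
  obtains H N where "(\<lambda>\<theta>. H (cis \<theta>)) \<in> L2 circle_measure" "\<And>k. N k \<ge> k"
    "(\<lambda>k. \<integral>\<theta>. (cmod (H (cis \<theta>) - analytic_polynomial c {..<N k} \<theta>))\<^sup>2 \<partial>circle_measure) \<longlonglongrightarrow> 0"
proof -
  \<comment> \<open>\<open>n \<ge> k\<close> makes the cut-offs tend to infinity even if only finitely many coefficients are nonzero\<close>
  define tail_small where "tail_small k n \<longleftrightarrow> n \<ge> k \<and> (\<forall>m\<ge>n. (\<Sum>i\<in>{n..<m}. (cmod (c i))\<^sup>2) \<le> (1/4) ^ k)"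
    for k n :: nat
  have ex: "\<exists>n. tail_small k n \<and> x \<le> n" for k x
  proof -
    obtain n0 where n0: "\<And>m n. m \<ge> n0 \<Longrightarrow> norm (\<Sum>i\<in>{m..<n}. (cmod (c i))\<^sup>2) < (1/4) ^ k"
      using c unfolding summable_Cauchy by (metis zero_less_power zero_less_divide_1_iff zero_less_numeral)
    have "tail_small k (max n0 (max k x))"
      unfolding tail_small_def using n0[of "max n0 (max k x)"] by (auto simp: sum_nonneg intro: less_imp_le)
    then show ?thesis
      by (intro exI[of _ "max n0 (max k x)"]) auto
  qed
  have "\<exists>N. \<forall>k. tail_small k (N k) \<and> N k \<le> N (Suc k)"
    by (rule dependent_nat_choice) (use ex in auto)
  then obtain N where N: "\<And>k. tail_small k (N k)" "\<And>k. N k \<le> N (Suc k)"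
    by blast
  have N_mono: "N k \<le> N m" if "k \<le> m" for k m
    using lift_Suc_mono_le[of N] N(2) that by blast
  define S where "S k = analytic_polynomial c {..<N k}" for k
  have S: "S k \<in> L2 circle_measure" for k
    unfolding S_def by (rule analytic_polynomial_L2)
  have fast: "(\<integral>\<theta>. (cmod (S m \<theta> - S k \<theta>))\<^sup>2 \<partial>circle_measure) \<le> (1/4) ^ k" if "k \<le> m" for k m
  proof -
    have "S m \<theta> - S k \<theta> = analytic_polynomial c {N k..<N m} \<theta>" for \<theta>
      unfolding S_def analytic_polynomial_def
      using sum_diff_nat_ivl[of 0 "N k" "N m"] N_mono[OF that] by (simp add: atLeast0LessThan)
    then show ?thesis
      using N(1)[of k] N_mono[OF that] by (simp add: norm_analytic_polynomial tail_small_def)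
  qed
  \<comment> \<open>where the sequence diverges, \<open>lim\<close> takes a default value that keeps \<open>H\<close> measurable\<close>
  define H where "H z = lim (\<lambda>k. \<Sum>n<N k. c n * z ^ n)" for z
  have H: "H (cis \<theta>) = lim (\<lambda>k. S k \<theta>)" for \<theta>
    by (simp add: H_def S_def analytic_polynomial_def Complex.DeMoivre)
  show thesis
  proof (rule that)
    show "(\<lambda>\<theta>. H (cis \<theta>)) \<in> L2 circle_measure"
      unfolding H by (rule circle.fast_L2_Cauchy_limit[OF S fast])
    show "(\<lambda>k. \<integral>\<theta>. (cmod (H (cis \<theta>) - analytic_polynomial c {..<N k} \<theta>))\<^sup>2 \<partial>circle_measure) \<longlonglongrightarrow> 0"
      unfolding H S_def[symmetric] by (rule circle.fast_L2_Cauchy_limit[OF S fast])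
    show "N k \<ge> k" for k
      using N(1)[of k] by (simp add: tail_small_def)
  qed
qed

text \<open>Inner products with \<open>H\<close> are limits of inner products with partial sums. Pairing with a character gives
  the coefficients of \<open>H\<close>; pairing with \<open>H\<close> times the character of index \<open>-j\<close>, whose coefficients are
  those of \<open>H\<close> shifted by \<open>j\<close>, expresses the coefficients of \<open>\<bar>H\<bar>\<^sup>2\<close> as autocorrelations.\<close>

lemma L2_function_of_coefficients:
  assumes c: "summable (\<lambda>n. (cmod (c n))\<^sup>2)"
  obtains H where "(\<lambda>\<theta>. H (cis \<theta>)) \<in> L2 circle_measure"
    "\<And>n. (\<integral>\<theta>. H (cis \<theta>) * cis (- (of_int n * \<theta>)) \<partial>circle_measure) = (if n \<ge> 0 then c (nat n) else 0)"
    "\<And>j. ((\<lambda>k. c (k + j) * cnj (c k)) has_sum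
        (\<integral>\<theta>. of_real ((cmod (H (cis \<theta>)))\<^sup>2) * cis (- (of_int (int j) * \<theta>)) \<partial>circle_measure)) UNIV"
proof -
  obtain H N where HN: "(\<lambda>\<theta>. H (cis \<theta>)) \<in> L2 circle_measure" "\<And>k. N k \<ge> k"
    "(\<lambda>k. \<integral>\<theta>. (cmod (H (cis \<theta>) - analytic_polynomial c {..<N k} \<theta>))\<^sup>2 \<partial>circle_measure) \<longlonglongrightarrow> 0"
    using Riesz_Fischer_analytic[OF c] by blast
  have N_top: "filterlim N at_top sequentially"
    using HN(2) by (intro filterlim_at_top_mono[OF filterlim_ident]) auto
  note lim = L2_inner_tendsto[OF _ HN(1) analytic_polynomial_L2 HN(3)]
  have coeff: "(\<integral>\<theta>. H (cis \<theta>) * cis (- (of_int n * \<theta>)) \<partial>circle_measure) = (if n \<ge> 0 then c (nat n) else 0)" for n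
  proof -
    have "\<forall>\<^sub>F k in sequentially. (if n \<ge> 0 then cnj (c (nat n)) else 0) =
        (\<integral>\<theta>. cis (of_int n * \<theta>) * cnj (analytic_polynomial c {..<N k} \<theta>) \<partial>circle_measure)"
      using eventually_gt_at_top[of "nat n"]
    proof eventually_elim
      case (elim k)
      then have "nat n < N k"
        using HN(2)[of k] by simp
      then show ?case
        by (simp add: inner_cis_analytic_polynomial)
    qed
    then have "(\<lambda>k. if n \<ge> 0 then cnj (c (nat n)) else 0)
        \<longlonglongrightarrow> (\<integral>\<theta>. cis (of_int n * \<theta>) * cnj (H (cis \<theta>)) \<partial>circle_measure)"
      using lim[OF cis_L2] by (rule tendsto_cong[THEN iffD2])
    then have "(\<integral>\<theta>. cis (of_int n * \<theta>) * cnj (H (cis \<theta>)) \<partial>circle_measure) = (if n \<ge> 0 then cnj (c (nat n)) else 0)"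
      using LIMSEQ_unique tendsto_const by blast
    then have "cnj (\<integral>\<theta>. cis (of_int n * \<theta>) * cnj (H (cis \<theta>)) \<partial>circle_measure) = (if n \<ge> 0 then c (nat n) else 0)"
      by simp
    then show ?thesis
      by (subst (asm) Bochner_Integration.integral_cnj[symmetric]) (simp add: cis_cnj mult.commute)
  qed
  have autocorrelation: "((\<lambda>k. c (k + j) * cnj (c k)) has_sum
      (\<integral>\<theta>. of_real ((cmod (H (cis \<theta>)))\<^sup>2) * cis (- (of_int (int j) * \<theta>)) \<partial>circle_measure)) UNIV"
      (is "(?a has_sum ?I) UNIV") for j
  proof -
    have "(\<lambda>k. (cmod (c (k + j)))\<^sup>2) summable_on UNIV" "(\<lambda>k. (cmod (c k))\<^sup>2) summable_on UNIV"
      using c summable_ignore_initial_segment[OF c, of j]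
      by (auto intro!: summable_nonneg_imp_summable_on)
    then have "?a summable_on UNIV"
      by (rule product_summable_on)
    then have a: "(?a has_sum infsum ?a UNIV) UNIV"
      by (rule has_sum_infsum)
    let ?g = "\<lambda>\<theta>. H (cis \<theta>) * cis (- of_int (int j) * \<theta>)"
    have g: "?g \<in> L2 circle_measure"
      using HN(1) by (rule L2_mult_cis)
    have "(\<integral>\<theta>. ?g \<theta> * cnj (analytic_polynomial c {..<N k} \<theta>) \<partial>circle_measure) = (\<Sum>n<N k. ?a n)" for k
    proof -
      have "(\<integral>\<theta>. ?g \<theta> * cis (- (of_int (int n) * \<theta>)) \<partial>circle_measure) = c (n + j)" for n
      proof -
        have "(\<integral>\<theta>. ?g \<theta> * cis (- (of_int (int n) * \<theta>)) \<partial>circle_measure)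
            = (\<integral>\<theta>. H (cis \<theta>) * cis (- (of_int (int (n + j)) * \<theta>)) \<partial>circle_measure)"
          by (simp add: mult.assoc cis_mult algebra_simps)
        then show ?thesis
          unfolding coeff by (simp del: of_nat_add)
      qed
      then show ?thesis
        by (subst inner_analytic_polynomial[OF g]) (simp add: mult.commute)
    qed
    then have "(\<lambda>k. \<Sum>n<N k. ?a n) \<longlonglongrightarrow> (\<integral>\<theta>. ?g \<theta> * cnj (H (cis \<theta>)) \<partial>circle_measure)"
      using lim[OF g] by simp
    also have "(\<integral>\<theta>. ?g \<theta> * cnj (H (cis \<theta>)) \<partial>circle_measure) = ?I"
      by (intro Bochner_Integration.integral_cong refl) (simp add: complex_norm_square mult_ac del: of_real_power)
    finally have "(\<lambda>k. \<Sum>n<N k. ?a n) \<longlonglongrightarrow> ?I" .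
    moreover have "(\<lambda>k. \<Sum>n<N k. ?a n) \<longlonglongrightarrow> infsum ?a UNIV"
      using filterlim_compose[OF has_sum_imp_sums[OF a, unfolded sums_def] N_top] .
    ultimately have "?I = infsum ?a UNIV"
      by (rule LIMSEQ_unique)
    with a show ?thesis
      by (simp only:)
  qed
  show thesis
    using that HN(1) coeff autocorrelation by blast
qed

section \<open>Uniqueness of Fourier coefficients\<close>

inductive trig_polynomial :: "(real \<Rightarrow> complex) \<Rightarrow> bool" where
  monomial: "trig_polynomial (\<lambda>\<theta>. c * cis (of_int n * \<theta>))"
| add: "trig_polynomial p \<Longrightarrow> trig_polynomial r \<Longrightarrow> trig_polynomial (\<lambda>\<theta>. p \<theta> + r \<theta>)"

lemma trig_polynomial_mult:
  assumes "trig_polynomial p" "trig_polynomial r"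
  shows "trig_polynomial (\<lambda>\<theta>. p \<theta> * r \<theta>)"
  using assms(1)
proof induction
  case (monomial c n)
  show ?case
    using assms(2)
  proof induction
    case (monomial d m)
    have "(\<lambda>\<theta>. c * cis (of_int n * \<theta>) * (d * cis (of_int m * \<theta>)))
        = (\<lambda>\<theta>. (c * d) * cis (of_int (n + m) * \<theta>))"
      by (simp add: fun_eq_iff algebra_simps flip: cis_mult)
    then show ?case
      by (simp only: trig_polynomial.monomial)
  next
    case (add p r)
    then show ?case
      using trig_polynomial.add[OF add.IH] by (simp add: distrib_left)
  qed
next
  case (add p s)
  then show ?case
    using trig_polynomial.add[OF add.IH] by (simp add: distrib_right)
qed

text \<open>A real-linear function of \<open>cis \<theta>\<close> is a combination of \<open>cos \<theta>\<close> and \<open>sin \<theta>\<close>, hence of the characters of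
  index \<open>1\<close> and \<open>-1\<close>.\<close>

lemma trig_polynomial_of_real_polynomial:
  fixes p :: "complex \<Rightarrow> real"
  assumes "real_polynomial_function p"
  shows "trig_polynomial (\<lambda>\<theta>. of_real (p (cis \<theta>)))"
  using assms
proof induction
  case (linear p)
  then interpret bounded_linear p .
  have p_cis: "p (cis \<theta>) = cos \<theta> * p 1 + sin \<theta> * p \<i>" for \<theta>
  proof -
    have "cis \<theta> = cos \<theta> *\<^sub>R 1 + sin \<theta> *\<^sub>R \<i>"
      by (simp add: complex_eq_iff)
    then show ?thesis
      by (simp only: add scaleR) simp
  qed
  have "(\<lambda>\<theta>. of_real (p (cis \<theta>))) = (\<lambda>\<theta>. (of_real (p 1) - \<i> * of_real (p \<i>)) / 2 * cis (of_int 1 * \<theta>)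
      + (of_real (p 1) + \<i> * of_real (p \<i>)) / 2 * cis (of_int (- 1) * \<theta>))"
    by (simp add: fun_eq_iff complex_eq_iff p_cis field_simps)
  then show ?case
    by (simp only: trig_polynomial.intros)
next
  case (const c)
  show ?case
    using trig_polynomial.monomial[of "of_real c" 0] by simp
next
  case (add p r)
  then show ?case
    using trig_polynomial.add[OF add.IH] by simp
next
  case (mult p r)
  then show ?case
    using trig_polynomial_mult[OF mult.IH] by simp
qed

lemma trig_polynomial_annihilated:
  assumes G: "integrable circle_measure G"
    and zero: "\<And>n. (\<integral>\<theta>. G \<theta> * cis (of_int n * \<theta>) \<partial>circle_measure) = 0"
    and "trig_polynomial p"
  shows "integrable circle_measure (\<lambda>\<theta>. G \<theta> * p \<theta>) \<and> (\<integral>\<theta>. G \<theta> * p \<theta> \<partial>circle_measure) = 0"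
  using assms(3)
proof induction
  case (monomial c n)
  have [measurable]: "G \<in> borel_measurable circle_measure"
    using G by (rule borel_measurable_integrable)
  have "integrable circle_measure (\<lambda>\<theta>. G \<theta> * cis (of_int n * \<theta>))"
    by (rule Bochner_Integration.integrable_bound[OF G]) (auto simp: norm_mult)
  then show ?case
    using zero[of n] by (simp add: mult.left_commute[of _ c])
next
  case (add p r)
  then show ?case
    by (simp add: distrib_left)
qed

text \<open>By the Stone--Weierstrass theorem on the unit circle, \<open>\<phi>\<close> is a uniform limit of polynomials in the real
  and imaginary part, which restrict to trigonometric polynomials.\<close>

lemma continuous_annihilated:
  fixes \<phi> :: "complex \<Rightarrow> real"
  assumes G: "integrable circle_measure G"
    and zero: "\<And>n. (\<integral>\<theta>. G \<theta> * cis (of_int n * \<theta>) \<partial>circle_measure) = 0"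
    and cont: "continuous_on UNIV \<phi>"
  shows "(\<integral>\<theta>. G \<theta> * of_real (\<phi> (cis \<theta>)) \<partial>circle_measure) = 0"
proof -
  have [measurable]: "G \<in> borel_measurable circle_measure"
    using G by (rule borel_measurable_integrable)
  have [measurable]: "\<phi> \<in> borel_measurable borel"
    using cont by (rule borel_measurable_continuous_onI)
  define C where "C = (\<integral>\<theta>. norm (G \<theta>) \<partial>circle_measure)"
  have C: "C \<ge> 0"
    by (simp add: C_def)
  have small: "norm (\<integral>\<theta>. G \<theta> * of_real (\<phi> (cis \<theta>)) \<partial>circle_measure) \<le> e * C" if e: "e > 0" for e
  proof -
    have "compact (sphere (0::complex) 1)" "continuous_on (sphere 0 1) \<phi>"
      using cont continuous_on_subset by auto
    then obtain p where p: "real_polynomial_function p" "\<And>z. z \<in> sphere 0 1 \<Longrightarrow> \<bar>\<phi> z - p z\<bar> < e"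
      using Stone_Weierstrass_real_polynomial_function[OF _ _ e] by blast
    have close: "\<bar>\<phi> (cis \<theta>) - p (cis \<theta>)\<bar> \<le> e" for \<theta>
      using p(2)[of "cis \<theta>"] by simp
    have pointwise: "norm (G \<theta> * of_real (\<phi> (cis \<theta>) - p (cis \<theta>))) \<le> e * norm (G \<theta>)" for \<theta>
      using mult_left_mono[OF close norm_ge_zero, of "G \<theta>" \<theta>]
      by (simp only: norm_mult norm_of_real mult.commute)
    have p_zero: "integrable circle_measure (\<lambda>\<theta>. G \<theta> * of_real (p (cis \<theta>)))"
      "(\<integral>\<theta>. G \<theta> * of_real (p (cis \<theta>)) \<partial>circle_measure) = 0"
      using trig_polynomial_annihilated[OF G zero trig_polynomial_of_real_polynomial[OF p(1)]] by auto
    have [measurable]: "p \<in> borel_measurable borel"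
      using p(1) continuous_on_polymonial_function
      by (intro borel_measurable_continuous_onI) (auto simp: real_polynomial_function_eq)
    have diff: "integrable circle_measure (\<lambda>\<theta>. G \<theta> * of_real (\<phi> (cis \<theta>) - p (cis \<theta>)))"
    proof (rule Bochner_Integration.integrable_bound)
      show "integrable circle_measure (\<lambda>\<theta>. e * norm (G \<theta>))"
        using G by auto
      show "AE \<theta> in circle_measure. norm (G \<theta> * of_real (\<phi> (cis \<theta>) - p (cis \<theta>))) \<le> norm (e * norm (G \<theta>))"
        by (rule AE_I2) (rule order_trans[OF pointwise], simp)
    qed measurable
    have "(\<integral>\<theta>. G \<theta> * of_real (\<phi> (cis \<theta>)) \<partial>circle_measure)
        = (\<integral>\<theta>. G \<theta> * of_real (\<phi> (cis \<theta>) - p (cis \<theta>)) + G \<theta> * of_real (p (cis \<theta>)) \<partial>circle_measure)"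
      by (simp add: algebra_simps)
    also have "\<dots> = (\<integral>\<theta>. G \<theta> * of_real (\<phi> (cis \<theta>) - p (cis \<theta>)) \<partial>circle_measure)"
      using Bochner_Integration.integral_add[OF diff p_zero(1)] p_zero(2) by simp
    also have "norm \<dots> \<le> (\<integral>\<theta>. norm (G \<theta> * of_real (\<phi> (cis \<theta>) - p (cis \<theta>))) \<partial>circle_measure)"
      by (rule integral_norm_bound)
    also have "\<dots> \<le> (\<integral>\<theta>. e * norm (G \<theta>) \<partial>circle_measure)"
      using diff G by (intro integral_mono pointwise integrable_norm integrable_mult_right)
    finally show ?thesis
      by (simp add: C_def)
  qed
  have "norm (\<integral>\<theta>. G \<theta> * of_real (\<phi> (cis \<theta>)) \<partial>circle_measure) \<le> r" if "r > 0" for r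
  proof -
    have "norm (\<integral>\<theta>. G \<theta> * of_real (\<phi> (cis \<theta>)) \<partial>circle_measure) \<le> r / (C + 1) * C"
      using that C by (intro small) simp
    also have "\<dots> \<le> r"
      using that C by (simp add: field_simps)
    finally show ?thesis .
  qed
  then have "norm (\<integral>\<theta>. G \<theta> * of_real (\<phi> (cis \<theta>)) \<partial>circle_measure) \<le> 0"
    by (rule dense_ge)
  then show ?thesis
    by (simp only: norm_le_zero_iff)
qed

text \<open>The indicator of a closed set is a bounded pointwise limit of continuous functions.\<close>

lemma closed_set_annihilated:
  assumes G: "integrable circle_measure G"
    and zero: "\<And>n. (\<integral>\<theta>. G \<theta> * cis (of_int n * \<theta>) \<partial>circle_measure) = 0"
    and K: "closed K" "K \<noteq> {}"
  shows "(\<integral>\<theta>. G \<theta> * indicator K (cis \<theta>) \<partial>circle_measure) = 0"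
proof -
  have [measurable]: "G \<in> borel_measurable circle_measure"
    using G by (rule borel_measurable_integrable)
  have [measurable]: "K \<in> sets borel"
    using K by auto
  define \<phi> where "\<phi> n z = max 0 (1 - real n * infdist z K)" for n z
  have cont: "continuous_on UNIV (\<phi> n)" for n
    unfolding \<phi>_def by (intro continuous_intros)
  then have [measurable]: "\<phi> n \<in> borel_measurable borel" for n
    by (rule borel_measurable_continuous_onI)
  have bound: "\<bar>\<phi> n z\<bar> \<le> 1" for n z
    by (auto simp: \<phi>_def infdist_nonneg)
  have lim: "(\<lambda>n. \<phi> n z) \<longlonglongrightarrow> indicator K z" for z
  proof (cases "z \<in> K")
    case True
    then show ?thesis
      by (simp add: \<phi>_def)
  next
    case False
    then have pos: "infdist z K > 0"
      using K by (simp add: infdist_pos_not_in_closed)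
    obtain n0 where n0: "1 < real n0 * infdist z K"
      using reals_Archimedean3[OF pos] by blast
    have "\<phi> n z = 0" if "n \<ge> n0" for n
    proof -
      have "real n0 * infdist z K \<le> real n * infdist z K"
        using that pos by (intro mult_right_mono) auto
      then show ?thesis
        using n0 by (simp add: \<phi>_def)
    qed
    then have "\<forall>\<^sub>F n in sequentially. \<phi> n z = 0"
      by (auto simp: eventually_sequentially)
    then show ?thesis
      using False by (simp add: tendsto_eventually)
  qed
  have "(\<lambda>n. \<integral>\<theta>. G \<theta> * of_real (\<phi> n (cis \<theta>)) \<partial>circle_measure)
      \<longlonglongrightarrow> (\<integral>\<theta>. G \<theta> * of_real (indicator K (cis \<theta>)) \<partial>circle_measure)"
  proof (rule integral_dominated_convergence)
    show "integrable circle_measure (\<lambda>\<theta>. norm (G \<theta>))"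
      using G by (rule integrable_norm)
    show "AE \<theta> in circle_measure. (\<lambda>n. G \<theta> * of_real (\<phi> n (cis \<theta>))) \<longlonglongrightarrow> G \<theta> * of_real (indicator K (cis \<theta>))"
      by (intro AE_I2 tendsto_intros lim)
    show "AE \<theta> in circle_measure. norm (G \<theta> * of_real (\<phi> n (cis \<theta>))) \<le> norm (G \<theta>)" for n
      using bound by (auto simp: norm_mult intro!: mult_left_le)
  qed measurable
  then have "(\<lambda>n. 0) \<longlonglongrightarrow> (\<integral>\<theta>. G \<theta> * of_real (indicator K (cis \<theta>)) \<partial>circle_measure)"
    by (simp only: continuous_annihilated[OF G zero cont])
  then have "(\<integral>\<theta>. G \<theta> * of_real (indicator K (cis \<theta>)) \<partial>circle_measure) = 0"
    using LIMSEQ_unique tendsto_const by blast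
  then show ?thesis
    by (simp add: of_real_indicator)
qed

lemma cis_mem_arc:
  assumes "0 < a" "0 < \<theta>" "\<theta> \<le> 2 * pi" "cis \<theta> \<in> cis ` {a..2*pi}"
  shows "a \<le> \<theta>"
proof (rule ccontr)
  assume "\<not> a \<le> \<theta>"
  then obtain t where t: "a \<le> t" "t \<le> 2 * pi" "cis \<theta> = cis t" "\<theta> < t"
    using assms by force
  then have "cis (t - \<theta>) = 1"
    by (simp flip: cis_divide)
  then obtain n :: int where n: "t - \<theta> = of_int n * (2 * pi)"
    by (metis cis.sel(1) cos_one_2pi_int mult.assoc one_complex.sel(1))
  have "0 < t - \<theta>" "t - \<theta> < 1 * (2 * pi)"
    using t assms by auto
  then have "0 < real_of_int n" "real_of_int n < 1"
    unfolding n by (simp_all add: zero_less_mult_iff)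
  then have "0 < n" "n < 1"
    by simp_all
  then show False
    by simp
qed

lemma AE_circle_measure_not: "AE \<theta> in circle_measure. \<theta> \<noteq> a"
  unfolding AE_circle_measure using AE_lborel_singleton[of a] by eventually_elim simp

text \<open>For \<open>0 < a \<le> 2\<pi>\<close>, on \<open>[0, 2\<pi>]\<close> the half-line beyond \<open>a\<close> and the closed arc \<open>cis ` {a..2*pi}\<close> pick out the same
  points up to the endpoints: \<open>a\<close> itself, and \<open>0\<close>, which has the same image as \<open>2\<pi>\<close>.\<close>

lemma half_line_annihilated:
  assumes G: "integrable circle_measure G"
    and zero: "\<And>n. (\<integral>\<theta>. G \<theta> * cis (of_int n * \<theta>) \<partial>circle_measure) = 0"
  shows "(\<integral>\<theta>. G \<theta> * indicator {a<..} \<theta> \<partial>circle_measure) = 0"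
proof -
  have [measurable]: "G \<in> borel_measurable circle_measure"
    using G by (rule borel_measurable_integrable)
  have range: "AE \<theta> in circle_measure. 0 < \<theta> \<and> \<theta> \<le> 2 * pi"
  proof -
    have "AE \<theta> in circle_measure. 0 \<le> \<theta> \<and> \<theta> \<le> 2 * pi"
      unfolding AE_circle_measure by simp
    then show ?thesis
      using AE_circle_measure_not[of 0] by eventually_elim auto
  qed
  consider "a \<le> 0" | "0 < a" "a \<le> 2 * pi" | "a > 2 * pi"
    by linarith
  then show ?thesis
  proof cases
    case 1
    have "AE \<theta> in circle_measure. G \<theta> * indicator {a<..} \<theta> = G \<theta> * cis (of_int 0 * \<theta>)"
      using range by eventually_elim (use 1 in \<open>auto simp: indicator_def\<close>)
    then have "(\<integral>\<theta>. G \<theta> * indicator {a<..} \<theta> \<partial>circle_measure) = (\<integral>\<theta>. G \<theta> * cis (of_int 0 * \<theta>) \<partial>circle_measure)"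
      by (intro integral_cong_AE) auto
    then show ?thesis
      using zero[of 0] by simp
  next
    case 2
    define K where "K = cis ` {a..2*pi}"
    have "compact K"
      unfolding K_def by (intro compact_continuous_image continuous_intros compact_Icc)
    then have K: "closed K" "K \<noteq> {}"
      using 2 by (auto simp: compact_imp_closed K_def)
    have [measurable]: "K \<in> sets borel"
      using K by auto
    have "AE \<theta> in circle_measure. G \<theta> * indicator {a<..} \<theta> = G \<theta> * indicator K (cis \<theta>)"
      using range AE_circle_measure_not[of a]
    proof eventually_elim
      case (elim \<theta>)
      then have "\<theta> > a \<longleftrightarrow> cis \<theta> \<in> K"
        using cis_mem_arc[of a \<theta>] 2 by (force simp: K_def)
      then show ?case
        by (simp add: indicator_def)
    qed
    then have "(\<integral>\<theta>. G \<theta> * indicator {a<..} \<theta> \<partial>circle_measure) = (\<integral>\<theta>. G \<theta> * indicator K (cis \<theta>) \<partial>circle_measure)"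
      by (intro integral_cong_AE) auto
    then show ?thesis
      using closed_set_annihilated[OF G zero K] by simp
  next
    case 3
    have "AE \<theta> in circle_measure. G \<theta> * indicator {a<..} \<theta> = 0"
      using range by eventually_elim (use 3 in \<open>auto simp: indicator_def\<close>)
    then have "(\<integral>\<theta>. G \<theta> * indicator {a<..} \<theta> \<partial>circle_measure) = (\<integral>\<theta>. 0 \<partial>circle_measure)"
      by (intro integral_cong_AE) auto
    then show ?thesis
      by simp
  qed
qed

lemma AE_zero_of_fourier_coefficients:
  assumes G: "integrable circle_measure G"
    and zero: "\<And>n. (\<integral>\<theta>. G \<theta> * cis (of_int n * \<theta>) \<partial>circle_measure) = 0"
  shows "AE \<theta> in circle_measure. G \<theta> = 0"
proof -
  have int: "integrable circle_measure (\<lambda>\<theta>. G \<theta> * indicator {a<..} \<theta>)" for a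
  proof -
    have "integrable circle_measure (\<lambda>\<theta>. indicator {a<..} \<theta> *\<^sub>R G \<theta>)"
      using G by (intro integrable_mult_indicator) auto
    then show ?thesis
      by (simp add: scaleR_conv_of_real of_real_indicator mult.commute)
  qed
  have "(\<integral>\<theta>. Re (G \<theta>) * indicator {a<..} \<theta> \<partial>circle_measure) = 0" for a
  proof -
    have "(\<integral>\<theta>. Re (G \<theta>) * indicator {a<..} \<theta> \<partial>circle_measure)
        = (\<integral>\<theta>. Re (G \<theta> * indicator {a<..} \<theta>) \<partial>circle_measure)"
      by (intro Bochner_Integration.integral_cong refl) (simp add: indicator_def)
    then show ?thesis
      using integral_Re[OF int[of a]] half_line_annihilated[OF G zero, of a] by simp
  qed
  then have re: "AE \<theta> in circle_measure. Re (G \<theta>) = 0"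
    using G by (intro AE_zero_of_half_lines) auto
  have "(\<integral>\<theta>. Im (G \<theta>) * indicator {a<..} \<theta> \<partial>circle_measure) = 0" for a
  proof -
    have "(\<integral>\<theta>. Im (G \<theta>) * indicator {a<..} \<theta> \<partial>circle_measure)
        = (\<integral>\<theta>. Im (G \<theta> * indicator {a<..} \<theta>) \<partial>circle_measure)"
      by (intro Bochner_Integration.integral_cong refl) (simp add: indicator_def)
    then show ?thesis
      using integral_Im[OF int[of a]] half_line_annihilated[OF G zero, of a] by simp
  qed
  then have "AE \<theta> in circle_measure. Im (G \<theta>) = 0"
    using G by (intro AE_zero_of_half_lines) auto
  with re show ?thesis
    by eventually_elim (simp add: complex_eq_iff)
qed

section \<open>Inner functions and autocorrelations\<close>

text \<open>The exceptional set on the line is covered by countably many translates of a null set that covers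
  its part in one period.\<close>

lemma AE_lborel_of_circle:
  assumes "AE \<theta> in circle_measure. P (cis \<theta>)"
  shows "AE \<theta> in lborel. P (cis \<theta>)"
proof -
  have "AE \<theta> in lborel. \<theta> \<in> {0..2*pi} \<longrightarrow> P (cis \<theta>)"
    using assms by (simp only: AE_circle_measure)
  then obtain N where N: "{\<theta> \<in> space lborel. \<not> (\<theta> \<in> {0..2*pi} \<longrightarrow> P (cis \<theta>))} \<subseteq> N"
    "emeasure lborel N = 0" "N \<in> sets lborel"
    by (rule AE_E)
  have "(\<Union>k::int. {\<theta>. \<theta> - 2 * pi * of_int k \<in> N}) \<in> null_sets lborel"
    using N by (intro null_sets_UN null_sets_translation) auto
  then show ?thesis
  proof (rule AE_I')
    show "{\<theta> \<in> space lborel. \<not> P (cis \<theta>)} \<subseteq> (\<Union>k::int. {\<theta>. \<theta> - 2 * pi * of_int k \<in> N})"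
    proof
      fix \<theta> :: real assume "\<theta> \<in> {\<theta> \<in> space lborel. \<not> P (cis \<theta>)}"
      then have not: "\<not> P (cis \<theta>)"
        by simp
      define k where "k = \<lfloor>\<theta> / (2 * pi)\<rfloor>"
      have "of_int k \<le> \<theta> / (2 * pi)" "\<theta> / (2 * pi) \<le> of_int k + 1"
        unfolding k_def by linarith+
      then have "\<theta> - 2 * pi * of_int k \<in> {0..2*pi}"
        by (simp add: field_simps)
      moreover have "cis (\<theta> - 2 * pi * of_int k) = cis \<theta>"
        using cis_multiple_2pi[of "of_int k"] by (simp flip: cis_divide)
      ultimately have "\<theta> - 2 * pi * of_int k \<in> N"
        using N(1) not by auto
      then show "\<theta> \<in> (\<Union>k::int. {\<theta>. \<theta> - 2 * pi * of_int k \<in> N})"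
        by blast
    qed
  qed
qed

text \<open>Expanding \<open>0 \<le> \<integral>\<bar>u - p\<bar>\<^sup>2\<close> for a partial sum \<open>p\<close> of the Fourier series of \<open>u\<close> bounds the sum of
  squared coefficients by \<open>\<integral>\<bar>u\<bar>\<^sup>2 = 1\<close>.\<close>

lemma Bessel_unimodular:
  assumes u: "u \<in> L2 circle_measure" and mod: "AE \<theta> in circle_measure. cmod (u \<theta>) = 1"
    and c: "\<And>n. c n = (\<integral>\<theta>. u \<theta> * cis (- (of_int (int n) * \<theta>)) \<partial>circle_measure)"
  shows "summable (\<lambda>n. (cmod (c n))\<^sup>2)"
proof -
  have "(\<Sum>n<N. (cmod (c n))\<^sup>2) \<le> 1" for N
  proof -
    let ?p = "analytic_polynomial c {..<N}"
    have "(\<integral>\<theta>. u \<theta> * cnj (?p \<theta>) \<partial>circle_measure) = (\<Sum>n<N. cnj (c n) * c n)"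
      by (simp only: inner_analytic_polynomial[OF u] c)
    also have "\<dots> = of_real (\<Sum>n<N. (cmod (c n))\<^sup>2)"
      by (simp add: complex_norm_square mult.commute of_real_sum del: of_real_power)
    finally have cross: "Re (\<integral>\<theta>. u \<theta> * cnj (?p \<theta>) \<partial>circle_measure) = (\<Sum>n<N. (cmod (c n))\<^sup>2)"
      by simp
    have int: "integrable circle_measure (\<lambda>\<theta>. u \<theta> * cnj (?p \<theta>))"
      using u analytic_polynomial_L2 by (rule L2_integrable_product)
    have u1: "(\<integral>\<theta>. (cmod (u \<theta>))\<^sup>2 \<partial>circle_measure) = (\<integral>\<theta>. 1 \<partial>circle_measure)"
    proof (rule integral_cong_AE)
      show "AE \<theta> in circle_measure. (cmod (u \<theta>))\<^sup>2 = 1"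
        using mod by eventually_elim simp
    qed (use L2_measurable[OF u] in measurable)
    have "0 \<le> (\<integral>\<theta>. (cmod (u \<theta> - ?p \<theta>))\<^sup>2 \<partial>circle_measure)"
      by simp
    also have "\<dots> = (\<integral>\<theta>. (cmod (u \<theta>))\<^sup>2 + (cmod (?p \<theta>))\<^sup>2 - 2 * Re (u \<theta> * cnj (?p \<theta>)) \<partial>circle_measure)"
      unfolding cmod_power2
      by (intro Bochner_Integration.integral_cong refl) (simp add: power2_eq_square algebra_simps)
    also have "\<dots> = (\<integral>\<theta>. (cmod (u \<theta>))\<^sup>2 \<partial>circle_measure) + (\<integral>\<theta>. (cmod (?p \<theta>))\<^sup>2 \<partial>circle_measure)
        - 2 * Re (\<integral>\<theta>. u \<theta> * cnj (?p \<theta>) \<partial>circle_measure)"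
      using L2_integrable_square[OF u] L2_integrable_square[OF analytic_polynomial_L2, of c "{..<N}"]
        int integral_Re[OF int] integrable_Re[OF int]
      by (simp del: complex_cnj_mult times_complex.sel)
    finally show ?thesis
      by (simp add: u1 cross norm_analytic_polynomial)
  qed
  then show ?thesis
    by (intro summableI_nonneg_bounded[where x = 1]) auto
qed

theorem inner_function_iff_autocorrelation:
  "(\<exists>F. inner_function F \<and> (\<forall>n. f n = fourier_coeff F n)) \<longleftrightarrow>
    (\<forall>n<0. f n = 0) \<and>
    (\<forall>j::nat. ((\<lambda>k. f (int (k + j)) * cnj (f (int k))) has_sum (if j = 0 then 1 else 0)) UNIV)"
    (is "?inner \<longleftrightarrow> ?analytic \<and> (\<forall>j. ?autocorrelation j)")
proof
  assume ?inner
  then obtain F where F: "inner_function F" "\<And>n. f n = fourier_coeff F n"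
    by blast
  define u where "u \<theta> = F (cis \<theta>)" for \<theta>
  have u_borel: "(\<lambda>\<theta>. F (cis \<theta>)) \<in> borel_measurable borel"
    using F(1) by (simp add: inner_function_def Linfty_circle_def)
  have f_eq: "f n = (\<integral>\<theta>. u \<theta> * cis (- (of_int n * \<theta>)) \<partial>circle_measure)" for n
    unfolding F(2) u_def by (rule fourier_coeff_eq[OF u_borel])
  have f_neg: "f n = 0" if "n < 0" for n
    using F that by (auto simp: inner_function_def)
  have mod: "AE \<theta> in circle_measure. cmod (u \<theta>) = 1"
    using F(1) unfolding AE_circle_measure inner_function_def u_def by (auto elim: eventually_mono)
  have u: "u \<in> L2 circle_measure"
  proof (rule circle.bounded_in_L2)
    show "u \<in> borel_measurable circle_measure"
      using u_borel unfolding u_def[abs_def] by measurable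
    show "AE \<theta> in circle_measure. cmod (u \<theta>) \<le> 1"
      using mod by eventually_elim simp
  qed
  have "summable (\<lambda>n. (cmod (f (int n)))\<^sup>2)"
    using u mod f_eq by (rule Bessel_unimodular)
  then obtain H where H: "(\<lambda>\<theta>. H (cis \<theta>)) \<in> L2 circle_measure"
    and H_coeff: "\<And>n. (\<integral>\<theta>. H (cis \<theta>) * cis (- (of_int n * \<theta>)) \<partial>circle_measure) = (if n \<ge> 0 then f (int (nat n)) else 0)"
    and H_auto: "\<And>j. ((\<lambda>k. f (int (k + j)) * cnj (f (int k))) has_sum
        (\<integral>\<theta>. of_real ((cmod (H (cis \<theta>)))\<^sup>2) * cis (- (of_int (int j) * \<theta>)) \<partial>circle_measure)) UNIV"
    by (rule L2_function_of_coefficients) blast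
  \<comment> \<open>the function built from the coefficients of \<open>u\<close> is \<open>u\<close> itself\<close>
  have diff_zero: "(\<integral>\<theta>. (u \<theta> - H (cis \<theta>)) * cis (of_int n * \<theta>) \<partial>circle_measure) = 0" for n
  proof -
    have "integrable circle_measure (\<lambda>\<theta>. u \<theta> * cis (of_int n * \<theta>))"
      "integrable circle_measure (\<lambda>\<theta>. H (cis \<theta>) * cis (of_int n * \<theta>))"
      using u H by (auto intro!: circle.L2_integrable L2_mult_cis)
    moreover have "f (- n) = (if - n \<ge> 0 then f (int (nat (- n))) else 0)"
      using f_neg by simp
    ultimately show ?thesis
      using f_eq[of "- n"] H_coeff[of "- n"] by (simp add: left_diff_distrib)
  qed
  have "AE \<theta> in circle_measure. u \<theta> - H (cis \<theta>) = 0"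
    using u H diff_zero
    by (intro AE_zero_of_fourier_coefficients circle.L2_integrable L2_diff)
  with mod have H_mod: "AE \<theta> in circle_measure. cmod (H (cis \<theta>)) = 1"
    by eventually_elim simp
  have "(\<integral>\<theta>. of_real ((cmod (H (cis \<theta>)))\<^sup>2) * cis (- (of_int (int j) * \<theta>)) \<partial>circle_measure)
      = (if j = 0 then 1 else 0)" for j
  proof -
    have [measurable]: "(\<lambda>\<theta>. H (cis \<theta>)) \<in> borel_measurable circle_measure"
      using H by (rule L2_measurable)
    have "(\<integral>\<theta>. of_real ((cmod (H (cis \<theta>)))\<^sup>2) * cis (- (of_int (int j) * \<theta>)) \<partial>circle_measure)
        = (\<integral>\<theta>. cis (of_int (- int j) * \<theta>) \<partial>circle_measure)"
    proof (rule integral_cong_AE)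
      show "AE \<theta> in circle_measure.
          of_real ((cmod (H (cis \<theta>)))\<^sup>2) * cis (- (of_int (int j) * \<theta>)) = cis (of_int (- int j) * \<theta>)"
        using H_mod by eventually_elim simp
    qed measurable
    then show ?thesis
      unfolding integral_cis by simp
  qed
  then have "?autocorrelation j" for j
    using H_auto[of j] by (simp only:)
  then show "?analytic \<and> (\<forall>j. ?autocorrelation j)"
    using f_neg by blast
next
  assume *: "?analytic \<and> (\<forall>j. ?autocorrelation j)"
  then have f_neg: "f n = 0" if "n < 0" for n
    using that by blast
  have "((\<lambda>k. complex_of_real ((cmod (f (int k)))\<^sup>2)) has_sum of_real 1) UNIV"
    using * by (auto dest: spec[of _ "0::nat"] simp: complex_norm_square simp del: of_real_power)
  then have "((\<lambda>k. (cmod (f (int k)))\<^sup>2) has_sum 1) UNIV"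
    by (simp only: has_sum_of_real_iff)
  then have "summable (\<lambda>n. (cmod (f (int n)))\<^sup>2)"
    using has_sum_imp_sums sums_summable by blast
  then obtain H where H: "(\<lambda>\<theta>. H (cis \<theta>)) \<in> L2 circle_measure"
    and H_coeff: "\<And>n. (\<integral>\<theta>. H (cis \<theta>) * cis (- (of_int n * \<theta>)) \<partial>circle_measure) = (if n \<ge> 0 then f (int (nat n)) else 0)"
    and H_auto: "\<And>j. ((\<lambda>k. f (int (k + j)) * cnj (f (int k))) has_sum
        (\<integral>\<theta>. of_real ((cmod (H (cis \<theta>)))\<^sup>2) * cis (- (of_int (int j) * \<theta>)) \<partial>circle_measure)) UNIV"
    by (rule L2_function_of_coefficients) blast
  define h where "h \<theta> = complex_of_real ((cmod (H (cis \<theta>)))\<^sup>2)" for \<theta>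
  have h: "integrable circle_measure h"
    unfolding h_def by (intro integrable_of_real L2_integrable_square H)
  have h_neg: "(\<integral>\<theta>. h \<theta> * cis (- (of_int (int j) * \<theta>)) \<partial>circle_measure) = (if j = 0 then 1 else 0)" for j
    unfolding h_def using H_auto[of j] * has_sum_unique by blast
  \<comment> \<open>as \<open>h\<close> is real, the coefficients of opposite index are conjugate\<close>
  have h_pos: "(\<integral>\<theta>. h \<theta> * cis (of_int (int j) * \<theta>) \<partial>circle_measure) = (if j = 0 then 1 else 0)" for j
  proof -
    have "(\<integral>\<theta>. h \<theta> * cis (of_int (int j) * \<theta>) \<partial>circle_measure)
        = (\<integral>\<theta>. cnj (h \<theta> * cis (- (of_int (int j) * \<theta>))) \<partial>circle_measure)"
      by (simp add: h_def cis_cnj)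
    also have "\<dots> = cnj (if j = 0 then 1 else 0)"
      unfolding Bochner_Integration.integral_cnj h_neg ..
    finally show ?thesis
      by simp
  qed
  have h_coeff: "(\<integral>\<theta>. h \<theta> * cis (of_int n * \<theta>) \<partial>circle_measure) = (if n = 0 then 1 else 0)" for n
    using h_pos[of "nat n"] h_neg[of "nat (- n)"] by (cases "n \<ge> 0") auto
  have h_cis: "integrable circle_measure (\<lambda>\<theta>. h \<theta> * cis (of_int n * \<theta>))" for n
    using borel_measurable_integrable[OF h]
    by (intro Bochner_Integration.integrable_bound[OF h]) (auto simp: norm_mult)
  have "AE \<theta> in circle_measure. h \<theta> - 1 = 0"
  proof (rule AE_zero_of_fourier_coefficients)
    show "integrable circle_measure (\<lambda>\<theta>. h \<theta> - 1)"
      using h by simp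
    show "(\<integral>\<theta>. (h \<theta> - 1) * cis (of_int n * \<theta>) \<partial>circle_measure) = 0" for n
      using h_cis[of n] circle.L2_integrable[OF cis_L2[of n]] h_coeff[of n] integral_cis[of n]
      by (simp add: left_diff_distrib)
  qed
  then have "AE \<theta> in circle_measure. cmod (H (cis \<theta>)) = 1"
  proof eventually_elim
    case (elim \<theta>)
    then have "(cmod (H (cis \<theta>)))\<^sup>2 = 1"
      unfolding h_def by (metis eq_iff_diff_eq_0 of_real_eq_1_iff)
    then show ?case
      by (simp add: power2_eq_1_iff) (smt (verit) norm_ge_zero)
  qed
  then have mod: "AE \<theta> in lborel. cmod (H (cis \<theta>)) = 1"
    by (rule AE_lborel_of_circle)
  have borel: "(\<lambda>\<theta>. H (cis \<theta>)) \<in> borel_measurable borel"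
    using L2_measurable[OF H] by simp
  have coeff: "f n = fourier_coeff H n" for n
    using f_neg H_coeff[of n] by (simp add: fourier_coeff_eq[OF borel])
  have "AE \<theta> in lborel. cmod (H (cis \<theta>)) \<le> 1"
    using mod by eventually_elim simp
  then have "inner_function H"
    using mod borel f_neg coeff by (auto simp: inner_function_def Linfty_circle_def)
  then show ?inner
    using coeff by blast
qed

section \<open>Isometries and inner functions\<close>

theorem corollary1p5:
  fixes q :: nat and f :: "int \<Rightarrow> complex"
  assumes "q \<ge> 2"
  shows "(\<exists>A. represents (tree q) (Gamma_kernel q f) A \<and> isometry_on_ell2 (tree q) A) \<longleftrightarrow>
         (\<exists>F. inner_function F \<and> (\<forall>n. f n = fourier_coeff F n))"
  using Gamma_isometry_iff[OF assms] inner_function_iff_autocorrelation by (simp only:)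

end
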